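(* Let $\mathcal{A}$ be a real affine hyperplane arrangement in $\mathbb{R}^n$, let $d$ be the dimension of its minimal faces, and let $t\in\mathbb{R}$. The intrinsic element \[\nu_t=\sum_{F\in\Sigma[\mathcal{A}]}(-1)^{\dim F}\Bigl(\sum_{k=d}^{\dim F}(-1)^k v_k(F)\,t^{k-d}\Bigr)\mathtt{H}_F\in\mathbb{R}\Sigma[\mathcal{A}]\] is characteristic of parameter $t$.
   Context: A real affine hyperplane arrangement $\mathcal{A}$ is a finite set of affine hyperplanes in $\mathbb{R}^n$. The hyperplanes split $\mathbb{R}^n$ into a finite collection $\Sigma[\mathcal{A}]$ of convex polyhedra called faces (the closures of the nonempty sets obtained by specifying, for each hyperplane, on which open side of it or on it the points lie). For faces $F,G$, the Tits product $FG$ is the unique face containing $F$ and a small segment starting at a point of the relative interior of $F$ in the direction of a point of the relative interior of $G$. A flat is a nonempty intersection of hyperplanes of $\mathcal{A}$ (the empty intersection being $\mathbb{R}^n$). The minimal faces (equivalently the minimal flats) all have dimension $d$; the rank of a face $F$ is $\dim F-d$ and the rank of a flat $X$ is $\dim X-d$. The support $\mathrm{supp}(F)$ is the smallest flat containing $F$. The Tits algebra $\mathbb{R}\Sigma[\mathcal{A}]$ has basis $\{\mathtt{H}_F\}$ with $\mathtt{H}_F\mathtt{H}_G=\mathtt{H}_{FG}$. For $w=\sum_F w^F\mathtt{H}_F$ and a flat $X$, $\chi_X(w)=\sum_{F:\,\mathrm{supp}(F)\subseteq X} w^F$; $w$ is characteristic of parameter $t$ if $\chi_X(w)=t^{\mathrm{rank}(X)}$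 for all flats $X$. Intrinsic volumes: for a closed convex polyhedral cone $C\subseteq\mathbb{R}^n$ and $k=0,\dots,n$, $v_k(C)$ is the proportion of (Gaussian) volume of $\mathbb{R}^n$ consisting of points whose nearest-point projection onto $C$ lies in the relative interior of a $k$-dimensional face of $C$. For a convex polyhedron $P$, $v_k(P)$ is defined as $v_k$ of its recession cone $\{y: x+\lambda y\in P\ \forall x\in P,\lambda\ge0\}$. *)

theory Defs
  imports "HOL-Analysis.Analysis" "HOL-Library.Poly_Mapping"
begin

section \<open>Affine hyperplane arrangements\<close>

definition hyperplane :: "'a::euclidean_space set \<Rightarrow> bool" where
  "hyperplane H \<longleftrightarrow> (\<exists>a b. a \<noteq> 0 \<and> H = {x. a \<bullet> x = b})"

text \<open>Both open sides of \<open>H\<close> are covered, since \<open>(- a, - b)\<close> defines the same hyperplane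
  as \<open>(a, b)\<close>.\<close>

definition open_side :: "'a::euclidean_space set \<Rightarrow> 'a set \<Rightarrow> bool" where
  "open_side H S \<longleftrightarrow> (\<exists>a b. a \<noteq> 0 \<and> H = {x. a \<bullet> x = b} \<and> S = {x. a \<bullet> x < b})"

definition hyperplane_arrangement :: "'a::euclidean_space set set \<Rightarrow> bool" where
  "hyperplane_arrangement \<A> \<longleftrightarrow> finite \<A> \<and> (\<forall>H\<in>\<A>. hyperplane H)"

definition cells :: "'a::euclidean_space set set \<Rightarrow> 'a set set" where
  "cells \<A> = {C. C \<noteq> {} \<and>
     (\<exists>s. (\<forall>H\<in>\<A>. s H = H \<or> open_side H (s H)) \<and> C = (\<Inter>H\<in>\<A>. s H))}"

definition faces :: "'a::euclidean_space set set \<Rightarrow> 'a set set" where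
  "faces \<A> = closure ` cells \<A>"

definition flats :: "'a::euclidean_space set set \<Rightarrow> 'a set set" where
  "flats \<A> = {X. X \<noteq> {} \<and> (\<exists>\<B>\<subseteq>\<A>. X = \<Inter>\<B>)}"

definition minimal_faces :: "'a::euclidean_space set set \<Rightarrow> 'a set set" where
  "minimal_faces \<A> = {F \<in> faces \<A>. \<forall>G\<in>faces \<A>. G \<subseteq> F \<longrightarrow> G = F}"

text \<open>Dimension of a nonempty set, as a natural number (faces and flats are nonempty).\<close>

definition pdim :: "'a::euclidean_space set \<Rightarrow> nat" where
  "pdim P = nat (aff_dim P)"

definition min_dim :: "'a::euclidean_space set set \<Rightarrow> nat" where
  "min_dim \<A> = (THE d. \<forall>F\<in>minimal_faces \<A>. pdim F = d)"

text \<open>The subtraction does not truncate on flats, all of which have dimension at least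
  \<open>min_dim \<A>\<close>.\<close>

definition flat_rank :: "'a::euclidean_space set set \<Rightarrow> 'a set \<Rightarrow> nat" where
  "flat_rank \<A> X = pdim X - min_dim \<A>"

text \<open>\<open>LEAST\<close> is taken with respect to inclusion.\<close>

definition supp :: "'a::euclidean_space set set \<Rightarrow> 'a set \<Rightarrow> 'a set" where
  "supp \<A> F = (LEAST X. X \<in> flats \<A> \<and> F \<subseteq> X)"

section \<open>The Tits algebra\<close>

text \<open>The small segment, without its starting point, is required to lie in the relative interior
  of the product: every larger face also contains the segment, so mere containment would not
  determine a unique face.\<close>

definition tits_product :: "'a::euclidean_space set set \<Rightarrow> 'a set \<Rightarrow> 'a set \<Rightarrow> 'a set" where
  "tits_product \<A> F G = (THE K. K \<in> faces \<A> \<and> F \<subseteq> K \<and>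
     (\<exists>x\<in>rel_interior F. \<exists>y\<in>rel_interior G. \<exists>\<epsilon>>0. \<forall>s. 0 < s \<and> s < \<epsilon> \<longrightarrow>
        x + s *\<^sub>R (y - x) \<in> rel_interior K))"

text \<open>The basis vector indexed by \<open>F\<close> is \<open>Poly_Mapping.single F 1\<close>; the coefficient of \<open>w\<close>
  at \<open>F\<close> is \<open>lookup w F\<close>.\<close>

definition tits_algebra :: "'a::euclidean_space set set \<Rightarrow> ('a set \<Rightarrow>\<^sub>0 real) set" where
  "tits_algebra \<A> = {w. Poly_Mapping.keys w \<subseteq> faces \<A>}"

definition tits_mult :: "'a::euclidean_space set set \<Rightarrow>
    ('a set \<Rightarrow>\<^sub>0 real) \<Rightarrow> ('a set \<Rightarrow>\<^sub>0 real) \<Rightarrow> ('a set \<Rightarrow>\<^sub>0 real)" where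
  "tits_mult \<A> u w = (\<Sum>F\<in>faces \<A>. \<Sum>G\<in>faces \<A>.
     Poly_Mapping.single (tits_product \<A> F G) (Poly_Mapping.lookup u F * Poly_Mapping.lookup w G))"

definition tits_char :: "'a::euclidean_space set set \<Rightarrow> 'a set \<Rightarrow> ('a set \<Rightarrow>\<^sub>0 real) \<Rightarrow> real" where
  "tits_char \<A> X w = (\<Sum>F\<in>{F \<in> faces \<A>. supp \<A> F \<subseteq> X}. Poly_Mapping.lookup w F)"

definition characteristic :: "'a::euclidean_space set set \<Rightarrow> real \<Rightarrow> ('a set \<Rightarrow>\<^sub>0 real) \<Rightarrow> bool" where
  "characteristic \<A> t w \<longleftrightarrow>
     w \<in> tits_algebra \<A> \<and> (\<forall>X\<in>flats \<A>. tits_char \<A> X w = t ^ flat_rank \<A> X)"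

section \<open>Intrinsic volumes\<close>

definition gaussian_measure :: "'a::euclidean_space measure" where
  "gaussian_measure = density lborel
     (\<lambda>x. ennreal (exp (- (norm x)\<^sup>2 / 2) / sqrt (2 * pi) ^ DIM('a)))"

definition cone_intrinsic_volume :: "nat \<Rightarrow> 'a::euclidean_space set \<Rightarrow> real" where
  "cone_intrinsic_volume k C = measure gaussian_measure
     {x. \<exists>T. T face_of C \<and> aff_dim T = int k \<and> closest_point C x \<in> rel_interior T}"

definition recession_cone :: "'a::euclidean_space set \<Rightarrow> 'a set" where
  "recession_cone P = {y. \<forall>x\<in>P. \<forall>c\<ge>0. x + c *\<^sub>R y \<in> P}"

definition intrinsic_volume :: "nat \<Rightarrow> 'a::euclidean_space set \<Rightarrow> real" where
  "intrinsic_volume k P = cone_intrinsic_volume k (recession_cone P)"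

definition intrinsic_element :: "'a::euclidean_space set set \<Rightarrow> real \<Rightarrow> ('a set \<Rightarrow>\<^sub>0 real)" where
  "intrinsic_element \<A> t = (\<Sum>F\<in>faces \<A>. Poly_Mapping.single F
     ((-1) ^ pdim F *
      (\<Sum>k = min_dim \<A>..pdim F. (-1) ^ k * intrinsic_volume k F * t ^ (k - min_dim \<A>))))"

end

theory Submission imports Defs "HOL-Probability.Distributions" begin

text \<open>Fix a flat \<open>X\<close> with direction space \<open>V\<close>, a point \<open>x\<close>, and for every face \<open>F \<subseteq> X\<close> let \<open>y\<^sub>F\<close> be
  the projection of \<open>x\<close> onto the recession cone of \<open>F\<close>. The identity holds pointwise: for every \<open>y\<close>,
  the sum of \<open>(-1)^dim F\<close> over the faces \<open>F \<subseteq> X\<close> with \<open>y\<^sub>F = y\<close> is \<open>(-1)^dim X\<close> if \<open>y\<close> is the projection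
  of \<open>x\<close> onto \<open>V\<close>, and \<open>0\<close> otherwise.

  Put \<open>z = x - y\<close>. Then \<open>y\<^sub>F = y\<close> iff \<open>z\<close> is orthogonal to \<open>y\<close>, \<open>y\<close> is a recession direction of \<open>F\<close>, and
  \<open>z\<close> is bounded above on \<open>F\<close> (Farkas). The open faces in \<open>X\<close> with recession direction \<open>y\<close> dissect a
  relatively open convex set, so their signed count is \<open>(-1)^dim X\<close>. If \<open>z\<close> is not orthogonal to \<open>V\<close>,
  those on which \<open>z\<close> is unbounded are the ones met by \<open>z \<bullet> q = c\<close> for large \<open>c\<close>; slicing there lowers
  all dimensions by one, so they have the same signed count and the bounded ones contribute \<open>0\<close>.

  The dimension of the face of the recession cone containing \<open>y\<^sub>F\<close> in its relative interior depends on
  \<open>y\<^sub>F\<close> only, and for almost every \<open>x\<close> it equals \<open>dim X\<close> at the projection of \<open>x\<close> onto \<open>V\<close>. Integrating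
  against the Gaussian measure gives \<open>(-1)^dim X\<close> for \<open>k = dim X\<close> and \<open>0\<close> otherwise as the alternating
  sum of the \<open>k\<close>-th intrinsic volumes of the faces in \<open>X\<close>.\<close>

section \<open>Euler characteristic of a dissected convex set\<close>

text \<open>A cell is named by one of its points instead of by a sign vector, so it is nonempty by
  construction and only realizable sign vectors occur. Different points may name the same
  cell.\<close>

definition sign_cell :: "'i set \<Rightarrow> ('i \<Rightarrow> 'a::euclidean_space) \<Rightarrow> ('i \<Rightarrow> real) \<Rightarrow> 'a \<Rightarrow> 'a set" where
  "sign_cell I n b p = {q. \<forall>i\<in>I. sgn (n i \<bullet> q - b i) = sgn (n i \<bullet> p - b i)}"

lemma int_pdim: "S \<noteq> {} \<Longrightarrow> int (pdim S) = aff_dim S"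
  using aff_dim_geq[of S] aff_dim_empty[of S] by (simp add: pdim_def)

lemma sign_cell_self: "p \<in> sign_cell I n b p"
  by (simp add: sign_cell_def)

lemma sign_cell_eq: "q \<in> sign_cell I n b p \<Longrightarrow> sign_cell I n b q = sign_cell I n b p"
  by (simp add: sign_cell_def)

lemma finite_range_sign_cell:
  assumes "finite I"
  shows "finite (range (sign_cell I n b))"
proof -
  define s where "s p = (\<lambda>i\<in>I. sgn (n i \<bullet> p - b i))" for p
  have "range s \<subseteq> I \<rightarrow>\<^sub>E {-1, 0, 1}"
    by (auto simp: s_def sgn_if split: if_splits)
  then have "finite (range s)"
    by (rule finite_subset) (simp add: finite_PiE assms)
  moreover have "sign_cell I n b p = {q. s q = s p}" for p
    by (auto simp: sign_cell_def s_def restrict_def fun_eq_iff)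
  then have "range (sign_cell I n b) = (\<lambda>t. {q. s q = t}) ` range s"
    by auto
  ultimately show ?thesis by simp
qed

lemma convex_rel_open_Int:
  fixes S T :: "'a::euclidean_space set"
  assumes "convex S" "rel_open S" "convex T" "rel_open T"
  shows "convex (S \<inter> T)" "rel_open (S \<inter> T)"
  using convex_rel_open_finite_Inter[of "{S, T}"] assms by auto

lemma rel_open_affine: "affine S \<Longrightarrow> rel_open S" for S :: "'a::euclidean_space set"
  by (simp add: rel_open_def rel_interior_affine)

lemma rel_open_open: "open S \<Longrightarrow> rel_open S" for S :: "'a::euclidean_space set"
  by (simp add: rel_open_def rel_interior_open)

text \<open>A relatively open set is an open part of its affine hull, so the dimensions of D and of
  its slice can be computed in the hull. The point q off the hyperplane makes the dimension drop;
  the point p makes the slice nonempty.\<close>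

lemma aff_dim_rel_open_Int_hyperplane:
  fixes D :: "'a::euclidean_space set"
  assumes "rel_open D" "p \<in> D" "a \<bullet> p = c" "q \<in> D" "a \<bullet> q \<noteq> c"
  shows "aff_dim (D \<inter> {x. a \<bullet> x = c}) = aff_dim D - 1"
proof -
  let ?H = "{x. a \<bullet> x = c}" and ?A = "affine hull D"
  obtain T where T: "open T" "D = ?A \<inter> T"
    using assms(1) unfolding rel_open openin_open by blast
  have aff: "affine (?A \<inter> ?H)"
    by (simp add: affine_hyperplane affine_Int)
  have *: "D \<inter> ?H = (?A \<inter> ?H) \<inter> T"
    by (subst T(2)) (simp only: Int_ac)
  have "p \<in> D \<inter> ?H" using assms by simp
  then have "aff_dim (D \<inter> ?H) = aff_dim (?A \<inter> ?H)"
    using aff_dim_convex_Int_open[OF affine_imp_convex[OF aff] T(1)] * by auto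
  also have "\<dots> = aff_dim ?A - 1"
  proof -
    have "p \<in> ?A" "q \<in> ?A" using assms by (simp_all add: hull_inc)
    then show ?thesis
      using assms by (subst aff_dim_affine_Int_hyperplane) (auto split: if_splits)
  qed
  finally show ?thesis by simp
qed

lemma rel_open_prolong:
  fixes D :: "'a::euclidean_space set"
  assumes "convex D" "rel_open D" "p \<in> D" "q \<in> D"
  obtains e where "e > 1" "(1 - e) *\<^sub>R p + e *\<^sub>R q \<in> D"
  using convex_rel_interior_iff[of D q] assms by (auto simp: rel_open_def)

text \<open>Empty pieces are discarded because \<open>pdim {}\<close> is 0, so that the empty set
  would add 1 to a signed count.\<close>

definition hyperplane_pieces :: "'a::euclidean_space \<Rightarrow> real \<Rightarrow> 'a set \<Rightarrow> 'a set set" where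
  "hyperplane_pieces a c D =
     {D \<inter> {x. a \<bullet> x = c}, D \<inter> {x. a \<bullet> x < c}, D \<inter> {x. a \<bullet> x > c}} - {{}}"

lemma Union_hyperplane_pieces: "\<Union>(hyperplane_pieces a c D) = D"
proof -
  have "\<Union>(hyperplane_pieces a c D) =
      D \<inter> ({x. a \<bullet> x = c} \<union> {x. a \<bullet> x < c} \<union> {x. a \<bullet> x > c})"
    unfolding hyperplane_pieces_def by blast
  moreover have "{x. a \<bullet> x = c} \<union> {x. a \<bullet> x < c} \<union> {x. a \<bullet> x > c} = UNIV"
    by (auto simp: not_less_iff_gr_or_eq)
  ultimately show ?thesis by simp
qed

lemma hyperplane_pieces_disjoint:
  assumes "E \<in> hyperplane_pieces a c D" "F \<in> hyperplane_pieces a c D" "E \<noteq> F"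
  shows "E \<inter> F = {}"
proof -
  have sides: "E = D \<inter> {x. a \<bullet> x = c} \<or> E = D \<inter> {x. a \<bullet> x < c} \<or> E = D \<inter> {x. a \<bullet> x > c}"
    if "E \<in> hyperplane_pieces a c D" for E
    using that by (simp add: hyperplane_pieces_def)
  have "D \<inter> {x. a \<bullet> x = c} \<inter> (D \<inter> {x. a \<bullet> x < c}) = {}"
    "D \<inter> {x. a \<bullet> x = c} \<inter> (D \<inter> {x. a \<bullet> x > c}) = {}"
    "D \<inter> {x. a \<bullet> x < c} \<inter> (D \<inter> {x. a \<bullet> x > c}) = {}"
    by auto
  then show ?thesis
    using sides[OF assms(1)] sides[OF assms(2)] assms(3) by (metis Int_commute)
qed

lemma hyperplane_pieces_convex_rel_open:
  assumes "convex D" "rel_open D" "E \<in> hyperplane_pieces a c D"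
  shows "convex E" "rel_open E" "E \<noteq> {}"
proof -
  have "convex {x. a \<bullet> x = c} \<and> rel_open {x. a \<bullet> x = c}"
    "convex {x. a \<bullet> x < c} \<and> rel_open {x. a \<bullet> x < c}"
    "convex {x. a \<bullet> x > c} \<and> rel_open {x. a \<bullet> x > c}"
    by (simp_all add: convex_hyperplane convex_halfspace_lt convex_halfspace_gt
        rel_open_affine rel_open_open affine_hyperplane open_halfspace_lt open_halfspace_gt)
  then show "convex E" "rel_open E" "E \<noteq> {}"
    using assms convex_rel_open_Int[OF assms(1,2)] unfolding hyperplane_pieces_def by blast+
qed

text \<open>If D has points strictly on both sides, the two open pieces keep its dimension m and the
  slice has dimension m - 1, and two terms of sign (-1)^m plus one of opposite sign leave (-1)^m.
  Otherwise D, being relatively open, lies in a single piece.\<close>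

lemma sum_hyperplane_pieces:
  fixes D :: "'a::euclidean_space set"
  assumes D: "convex D" "rel_open D" "D \<noteq> {}"
  shows "(\<Sum>E\<in>hyperplane_pieces a c D. (-1) ^ pdim E) = ((-1) ^ pdim D :: real)"
proof (cases "(\<exists>p\<in>D. a \<bullet> p < c) \<and> (\<exists>p\<in>D. a \<bullet> p > c)")
  case True
  then obtain p q where p: "p \<in> D" "a \<bullet> p < c" and q: "q \<in> D" "a \<bullet> q > c" by blast
  have "connected D" using D(1) by (rule convex_connected)
  then obtain r where r: "r \<in> D" "a \<bullet> r = c"
    using connected_ivt_hyperplane[of D p q a c] p q by fastforce
  let ?E = "D \<inter> {x. a \<bullet> x = c}" and ?L = "D \<inter> {x. a \<bullet> x < c}" and ?G = "D \<inter> {x. a \<bullet> x > c}"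
  have ne: "?E \<noteq> {}" "?L \<noteq> {}" "?G \<noteq> {}" using p q r by auto
  have "aff_dim ?L = aff_dim D" "aff_dim ?G = aff_dim D"
    using ne D by (intro aff_dim_convex_Int_open; simp add: open_halfspace_lt open_halfspace_gt)+
  moreover have "aff_dim ?E = aff_dim D - 1"
    using aff_dim_rel_open_Int_hyperplane[OF D(2) r p(1)] p(2) by simp
  ultimately have "pdim ?L = pdim D" "pdim ?G = pdim D" "pdim D = Suc (pdim ?E)"
    using int_pdim[OF ne(1)] int_pdim[OF ne(2)] int_pdim[OF ne(3)] int_pdim[OF D(3)] by linarith+
  moreover have "?E \<noteq> ?L" "?E \<noteq> ?G" "?L \<noteq> ?G" using p q r by force+
  moreover have "hyperplane_pieces a c D = {?E, ?L, ?G}"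
    using ne unfolding hyperplane_pieces_def by simp
  ultimately show ?thesis by simp
next
  case False
  have "(\<forall>p\<in>D. a \<bullet> p < c) \<or> (\<forall>p\<in>D. a \<bullet> p = c) \<or> (\<forall>p\<in>D. a \<bullet> p > c)"
  proof (rule ccontr)
    assume neg: "\<not> ?thesis"
    then obtain p q where pq: "p \<in> D" "a \<bullet> p \<noteq> c" "q \<in> D" "a \<bullet> q = c"
      using False by (metis linorder_neqE)
    \<comment> \<open>Prolonging the segment from p beyond the point q of the hyperplane leads to
      the side opposite to p.\<close>
    obtain e where e: "e > 1" "(1 - e) *\<^sub>R p + e *\<^sub>R q \<in> D"
      using rel_open_prolong[OF D(1,2) pq(1,3)] .
    have "a \<bullet> ((1 - e) *\<^sub>R p + e *\<^sub>R q) - c = (1 - e) * (a \<bullet> p - c)"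
      using pq by (simp add: algebra_simps)
    then have "a \<bullet> ((1 - e) *\<^sub>R p + e *\<^sub>R q) < c \<longleftrightarrow> a \<bullet> p > c"
      "a \<bullet> ((1 - e) *\<^sub>R p + e *\<^sub>R q) > c \<longleftrightarrow> a \<bullet> p < c"
      using e(1) by (smt (verit) mult_less_0_iff zero_less_mult_iff)+
    then show False using False e(2) pq(1,2) by (metis linorder_neqE)
  qed
  then have "hyperplane_pieces a c D = {D}"
  proof (elim disjE)
    assume "\<forall>p\<in>D. a \<bullet> p < c"
    then have "D \<inter> {x. a \<bullet> x = c} = {}" "D \<inter> {x. a \<bullet> x < c} = D" "D \<inter> {x. a \<bullet> x > c} = {}"
      by fastforce+
    then show ?thesis using D(3) by (auto simp: hyperplane_pieces_def)
  next
    assume "\<forall>p\<in>D. a \<bullet> p = c"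
    then have "D \<inter> {x. a \<bullet> x = c} = D" "D \<inter> {x. a \<bullet> x < c} = {}" "D \<inter> {x. a \<bullet> x > c} = {}"
      by fastforce+
    then show ?thesis using D(3) by (auto simp: hyperplane_pieces_def)
  next
    assume "\<forall>p\<in>D. a \<bullet> p > c"
    then have "D \<inter> {x. a \<bullet> x = c} = {}" "D \<inter> {x. a \<bullet> x < c} = {}" "D \<inter> {x. a \<bullet> x > c} = D"
      by fastforce+
    then show ?thesis using D(3) by (auto simp: hyperplane_pieces_def)
  qed
  then show ?thesis by simp
qed

text \<open>Within one piece the sign of the new form is constant, so inside that piece only the old
  forms distinguish cells.\<close>

lemma sign_cell_insert_Int:
  assumes "E \<in> hyperplane_pieces (n i) (b i) U" "p \<in> E"
  shows "sign_cell (insert i I) n b p \<inter> U = sign_cell I n b p \<inter> E"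
proof -
  have "q \<in> E \<longleftrightarrow> q \<in> U \<and> sgn (n i \<bullet> q - b i) = sgn (n i \<bullet> p - b i)" for q
  proof -
    consider "E = U \<inter> {x. n i \<bullet> x = b i}" | "E = U \<inter> {x. n i \<bullet> x < b i}"
      | "E = U \<inter> {x. n i \<bullet> x > b i}"
      using assms(1) by (auto simp: hyperplane_pieces_def)
    then show ?thesis using assms(2) by cases (auto simp: sgn_if)
  qed
  then show ?thesis by (auto simp: sign_cell_def)
qed

text \<open>Induction on the forms with U arbitrary: the hyperplane of the new form cuts U into
  convex relatively open pieces, the induction hypothesis counts the cells inside each piece, and
  \<open>sum_hyperplane_pieces\<close> adds up the pieces.\<close>

lemma euler_sign_cells:
  fixes U :: "'a::euclidean_space set"
  assumes "finite I" "convex U" "rel_open U" "U \<noteq> {}"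
  shows "(\<Sum>D\<in>(\<lambda>p. sign_cell I n b p \<inter> U) ` U. (-1) ^ pdim D) = ((-1) ^ pdim U :: real)"
  using assms
proof (induction I arbitrary: U)
  case empty
  then have "(\<lambda>p. sign_cell {} n b p \<inter> U) ` U = {U}" by (auto simp: sign_cell_def)
  then show ?case by simp
next
  case (insert i I)
  let ?P = "hyperplane_pieces (n i) (b i) U"
  let ?C = "\<lambda>E. (\<lambda>p. sign_cell I n b p \<inter> E) ` E"
  have "(\<lambda>p. sign_cell (insert i I) n b p \<inter> U) ` U = (\<Union>E\<in>?P. (\<lambda>p. sign_cell (insert i I) n b p \<inter> U) ` E)"
    by (subst (2) Union_hyperplane_pieces[of "n i" "b i" U, symmetric]) (simp only: image_Union)
  also have "\<dots> = (\<Union>E\<in>?P. ?C E)"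
    by (rule SUP_cong[OF refl], rule image_cong[OF refl], erule sign_cell_insert_Int)
  finally have eq: "(\<lambda>p. sign_cell (insert i I) n b p \<inter> U) ` U = (\<Union>E\<in>?P. ?C E)" .
  have "(\<Sum>D\<in>(\<Union>E\<in>?P. ?C E). (-1) ^ pdim D) = (\<Sum>E\<in>?P. \<Sum>D\<in>?C E. (-1) ^ pdim D :: real)"
  proof (rule sum.UNION_disjoint)
    show "finite ?P" by (simp add: hyperplane_pieces_def)
    show "\<forall>E\<in>?P. finite (?C E)"
    proof
      fix E
      have "?C E \<subseteq> (\<lambda>C. C \<inter> E) ` range (sign_cell I n b)" by blast
      then show "finite (?C E)"
        by (rule finite_subset) (intro finite_imageI finite_range_sign_cell insert.hyps)
    qed
    show "\<forall>E\<in>?P. \<forall>F\<in>?P. E \<noteq> F \<longrightarrow> ?C E \<inter> ?C F = {}"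
    proof (intro ballI impI)
      fix E F assume "E \<in> ?P" "F \<in> ?P" "E \<noteq> F"
      then have disj: "E \<inter> F = {}" by (rule hyperplane_pieces_disjoint)
      have sub: "D \<noteq> {} \<and> D \<subseteq> G" if "D \<in> ?C G" for D G
        using that by (auto intro: sign_cell_self)
      show "?C E \<inter> ?C F = {}"
      proof (rule equals0I)
        fix D assume "D \<in> ?C E \<inter> ?C F"
        then have "D \<noteq> {}" "D \<subseteq> E \<inter> F" using sub[of D E] sub[of D F] by simp_all
        then show False using disj by simp
      qed
    qed
  qed
  also have "\<dots> = (\<Sum>E\<in>?P. (-1) ^ pdim E)"
    by (intro sum.cong refl insert.IH hyperplane_pieces_convex_rel_open[OF insert.prems(1,2)])
  also have "\<dots> = (-1) ^ pdim U" using insert.prems by (rule sum_hyperplane_pieces)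
  finally show ?case unfolding eq .
qed

section \<open>The Gaussian measure\<close>

lemma nn_integral_std_normal_density: "(\<integral>\<^sup>+x. ennreal (std_normal_density x) \<partial>lborel) = 1"
  by (subst nn_integral_eq_integral) auto

text \<open>The density factors over the coordinates into standard normal densities, each of total
  mass 1.\<close>

lemma prob_space_gaussian_measure:
  "prob_space (gaussian_measure :: 'a::euclidean_space measure)"
proof
  have *: "exp (- (norm x)\<^sup>2 / 2) / sqrt (2 * pi) ^ DIM('a) =
        (\<Prod>i\<in>Basis. std_normal_density (x \<bullet> i))" for x :: 'a
  proof -
    have "(norm x)\<^sup>2 = (\<Sum>i\<in>Basis. (x \<bullet> i)\<^sup>2)"
      by (subst power2_norm_eq_inner, subst euclidean_inner) (simp add: power2_eq_square)
    then have "exp (- (norm x)\<^sup>2 / 2) = (\<Prod>i\<in>Basis. exp (- (x \<bullet> i)\<^sup>2 / 2))"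
      by (simp add: exp_sum[symmetric] sum_negf sum_divide_distrib)
    then show ?thesis
      by (simp add: std_normal_density_def prod.distrib prod_dividef power_divide)
  qed
  have "emeasure (gaussian_measure :: 'a measure) (space gaussian_measure) =
      (\<integral>\<^sup>+x. (\<Prod>i\<in>Basis. ennreal (std_normal_density (x \<bullet> i))) \<partial>(lborel :: 'a measure))"
    unfolding gaussian_measure_def * by (subst emeasure_density) (simp_all add: prod_ennreal)
  also have "\<dots> = 1"
    by (subst nn_integral_lborel_prod) (auto simp: nn_integral_std_normal_density)
  finally show "emeasure (gaussian_measure :: 'a measure) (space gaussian_measure) = 1" .
qed

lemma sets_gaussian_measure [simp, measurable_cong]: "sets gaussian_measure = sets borel"
  by (simp add: gaussian_measure_def)

lemma space_gaussian_measure [simp]: "space gaussian_measure = UNIV"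
  by (simp add: gaussian_measure_def)

lemma AE_gaussian_inner_neq_0:
  fixes a :: "'a::euclidean_space"
  assumes "a \<noteq> 0"
  shows "AE x in gaussian_measure. a \<bullet> x \<noteq> 0"
proof -
  have "{x. a \<bullet> x = 0} \<in> null_sets lebesgue"
    using negligible_hyperplane[of a 0] assms by (simp add: negligible_iff_null_sets)
  then have "{x. a \<bullet> x = 0} \<in> null_sets lborel"
    by (simp add: null_sets_completion_iff[symmetric] )
  then have "AE x in lborel. a \<bullet> x \<noteq> 0"
    by (rule AE_I') auto
  then show ?thesis
    unfolding gaussian_measure_def by (subst AE_density) auto
qed

section \<open>Cells of a finite family of affine forms\<close>

text \<open>The sign vector s is arbitrary, so that this covers the cells and also the regions
  \<open>far\<close> below, whose prescribed signs come from a direction.\<close>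

lemma convex_rel_open_sign_region:
  fixes n :: "'i \<Rightarrow> 'a::euclidean_space"
  assumes "finite K"
  shows "convex {q. \<forall>i\<in>K. sgn (n i \<bullet> q - b i) = s i}" (is "convex ?R")
    and "rel_open {q. \<forall>i\<in>K. sgn (n i \<bullet> q - b i) = s i}"
proof -
  have 1: "convex {q. sgn (a \<bullet> q - c) = t} \<and> rel_open {q. sgn (a \<bullet> q - c) = t}"
    for a :: 'a and c t :: real
  proof -
    consider "{q. sgn (a \<bullet> q - c) = t} = {q. a \<bullet> q = c}" | "{q. sgn (a \<bullet> q - c) = t} = {q. a \<bullet> q < c}"
      | "{q. sgn (a \<bullet> q - c) = t} = {q. a \<bullet> q > c}" | "{q. sgn (a \<bullet> q - c) = t} = {}"
    proof -
      have "t = 0 \<or> t = 1 \<or> t = -1 \<or> {q. sgn (a \<bullet> q - c) = t} = {}" by (auto simp: sgn_if)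
      then show thesis
      proof (elim disjE)
        assume "t = 0" then show thesis by (intro that(1)) (auto simp: sgn_if)
      next
        assume "t = 1" then show thesis by (intro that(3)) (auto simp: sgn_if)
      next
        assume "t = -1" then show thesis by (intro that(2)) (auto simp: sgn_if)
      qed (rule that(4))
    qed
    then show ?thesis
      by cases (simp_all add: convex_hyperplane convex_halfspace_lt convex_halfspace_gt
        rel_open_affine rel_open_open affine_hyperplane open_halfspace_lt open_halfspace_gt)
  qed
  have "?R = \<Inter>((\<lambda>i. {q. sgn (n i \<bullet> q - b i) = s i}) ` K)" by auto
  moreover have "convex (\<Inter>((\<lambda>i. {q. sgn (n i \<bullet> q - b i) = s i}) ` K)) \<and>
      rel_open (\<Inter>((\<lambda>i. {q. sgn (n i \<bullet> q - b i) = s i}) ` K))"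
    by (rule convex_rel_open_finite_Inter) (auto simp: 1 assms)
  ultimately show "convex ?R" "rel_open ?R" by simp_all
qed

section \<open>Projection onto closed convex cones, and Farkas' lemma\<close>

text \<open>Testing the variational inequality of the projection at u = 0 and at u = 2y gives
  orthogonality. Conversely, the cross term in the expansion of the squared norm of (x - y) + (y -
  u) is nonnegative.\<close>

lemma closest_point_cone_iff:
  fixes K :: "'a::euclidean_space set"
  assumes K: "convex_cone K" "closed K"
  shows "closest_point K x = y \<longleftrightarrow> y \<in> K \<and> (x - y) \<bullet> y = 0 \<and> (\<forall>u\<in>K. (x - y) \<bullet> u \<le> 0)"
proof
  have cv: "convex K" and ne: "K \<noteq> {}" using K(1) by (auto simp: convex_cone_def)
  have zero: "0 \<in> K" using K(1) by (rule convex_cone_contains_0)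
  {
    assume y: "closest_point K x = y"
    then have yK: "y \<in> K" using closest_point_in_set[OF K(2) ne] by blast
    have *: "(x - y) \<bullet> (u - y) \<le> 0" if "u \<in> K" for u
      using closest_point_dot[OF cv K(2) that, of x] y by simp
    have "2 *\<^sub>R y \<in> K" using convex_cone_scaleR[OF K(1) _ yK] by simp
    then have "(x - y) \<bullet> y = 0"
      using *[OF zero] *[of "2 *\<^sub>R y"] by (simp add: scaleR_2)
    then show "y \<in> K \<and> (x - y) \<bullet> y = 0 \<and> (\<forall>u\<in>K. (x - y) \<bullet> u \<le> 0)"
      using yK * by (simp add: inner_diff_right)
  }
  assume y: "y \<in> K \<and> (x - y) \<bullet> y = 0 \<and> (\<forall>u\<in>K. (x - y) \<bullet> u \<le> 0)"
  have "dist x y \<le> dist x u" if "u \<in> K" for u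
  proof -
    have "(norm (x - y))\<^sup>2 \<le> (norm (x - y))\<^sup>2 + (norm (y - u))\<^sup>2 + 2 * ((x - y) \<bullet> (y - u))"
    proof -
      have "(x - y) \<bullet> u \<le> 0" "(x - y) \<bullet> y = 0" using y that by blast+
      then have "(x - y) \<bullet> (y - u) \<ge> 0" by (simp add: inner_diff_right[of "x - y"])
      then show ?thesis by (smt (verit) zero_le_power2)
    qed
    also have "\<dots> = (norm ((x - y) + (y - u)))\<^sup>2"
      by (simp only: power2_norm_eq_inner inner_add_left inner_add_right inner_commute[of "y - u" "x - y"])
    finally show ?thesis by (simp add: dist_norm)
  qed
  then show "closest_point K x = y"
    using closest_point_unique[OF cv K(2)] y by blast
qed

text \<open>Allows boundedness to pass from generators to their conic hull by
  \<open>hull_minimal\<close>; the bound M may depend on the functional.\<close>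

lemma convex_cone_bounded_functionals:
  "convex_cone {z. \<exists>M. \<forall>q\<in>S. z \<bullet> q \<le> (M::real)}"
proof -
  let ?B = "{z. \<exists>M. \<forall>q\<in>S. z \<bullet> q \<le> (M::real)}"
  have "0 \<in> ?B" by (auto intro: exI[of _ 0])
  moreover have "x + y \<in> ?B" if "x \<in> ?B" "y \<in> ?B" for x y
  proof -
    from that obtain M N where "\<forall>q\<in>S. x \<bullet> q \<le> M" "\<forall>q\<in>S. y \<bullet> q \<le> N" by blast
    then show ?thesis by (auto simp: inner_add_left intro!: exI[of _ "M + N"] add_mono)
  qed
  moreover have "c *\<^sub>R x \<in> ?B" if "x \<in> ?B" "c \<ge> 0" for x and c :: real
  proof -
    from that obtain M where "\<forall>q\<in>S. x \<bullet> q \<le> M" by blast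
    then show ?thesis using that(2) by (auto intro!: exI[of _ "c * M"] mult_left_mono)
  qed
  ultimately show ?thesis unfolding convex_cone_iff by blast
qed

text \<open>Farkas' lemma, from the closedness of finitely generated cones.\<close>

lemma farkas_convex_cone_hull:
  fixes S :: "'a::euclidean_space set"
  assumes "finite S" "\<And>u. (\<And>s. s \<in> S \<Longrightarrow> s \<bullet> u \<le> 0) \<Longrightarrow> z \<bullet> u \<le> 0"
  shows "z \<in> convex_cone hull S"
proof (rule ccontr)
  let ?K = "convex_cone hull S"
  assume "z \<notin> ?K"
  then obtain a c where ac: "a \<bullet> z < c" "\<And>x. x \<in> ?K \<Longrightarrow> a \<bullet> x > c"
    using separating_hyperplane_closed_point[OF convex_convex_cone_hull closed_convex_cone_hull[OF assms(1)]]
    by metis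
  have c: "c < 0" using ac(2)[of 0] by (simp add: convex_cone_hull_contains_0)
  have "s \<bullet> (- a) \<le> 0" if "s \<in> S" for s
  proof (rule ccontr)
    assume "\<not> ?thesis"
    then have neg: "a \<bullet> s < 0" by (simp add: inner_commute)
    \<comment> \<open>On this nonnegative multiple of s the functional a takes exactly the value c,
      against the strict separation.\<close>
    have "(c / (a \<bullet> s)) *\<^sub>R s \<in> ?K"
      using that neg c by (intro convex_cone_hull_mul hull_inc) (auto simp: divide_nonpos_neg)
    from ac(2)[OF this] show False using neg by simp
  qed
  then have "z \<bullet> (- a) \<le> 0" by (rule assms(2))
  then show False using ac(1) c by (simp add: inner_commute)
qed

section \<open>Cells, their closures and their recession cones\<close>

locale affine_forms =
  fixes I :: "'i set" and n :: "'i \<Rightarrow> 'a::euclidean_space" and b :: "'i \<Rightarrow> real"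
  assumes finite_I: "finite I"
begin

abbreviation g :: "'i \<Rightarrow> 'a \<Rightarrow> real" where "g i p \<equiv> n i \<bullet> p - b i"

abbreviation cell :: "'a \<Rightarrow> 'a set" where "cell \<equiv> sign_cell I n b"

lemmas finite_cells = finite_range_sign_cell[OF finite_I, of n b]

lemma convex_cell: "convex (cell p)" and rel_open_cell: "rel_open (cell p)"
  unfolding sign_cell_def by (rule convex_rel_open_sign_region[OF finite_I])+

text \<open>The open cell can be recovered from its face, so \<open>closure\<close> is a bijection
  from cells to faces.\<close>

lemma rel_interior_closure_cell: "rel_interior (closure (cell p)) = cell p"
  using convex_rel_interior_closure[OF convex_cell] rel_open_cell by (simp add: rel_open_def)

lemma inj_on_closure_cells: "inj_on closure (range cell)"
  by (rule inj_on_inverseI[of _ rel_interior]) (auto simp: rel_interior_closure_cell)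

lemma pdim_closure_cell: "pdim (closure C) = pdim C"
  by (simp add: pdim_def)

text \<open>From a point q satisfying the weak inequalities, any step towards p restores the signs
  of p, since each form is then a convex combination with positive weight on its value at p. A form
  vanishing at p triggers both implications and must vanish at q.\<close>

lemma closure_cell:
  "closure (cell p) = {q. \<forall>i\<in>I. (g i p \<le> 0 \<longrightarrow> g i q \<le> 0) \<and> (g i p \<ge> 0 \<longrightarrow> g i q \<ge> 0)}"
  (is "_ = ?R")
proof
  have sgn_le: "(v \<le> 0 \<longrightarrow> u \<le> 0) \<and> (v \<ge> 0 \<longrightarrow> u \<ge> 0)" if "sgn u = sgn v" for u v :: real
    using that by (auto simp: sgn_if split: if_splits)
  have "?R = (\<Inter>i\<in>I. (if g i p \<le> 0 then {q. n i \<bullet> q \<le> b i} else UNIV) \<inter>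
      (if g i p \<ge> 0 then {q. n i \<bullet> q \<ge> b i} else UNIV))"
    by (auto split: if_splits)
  then have "closed ?R"
    by (simp add: closed_INT closed_Int closed_halfspace_le closed_halfspace_ge)
  moreover have "cell p \<subseteq> ?R"
    using sgn_le by (fastforce simp: sign_cell_def)
  ultimately show "closure (cell p) \<subseteq> ?R" by (rule closure_minimal[rotated])
  show "?R \<subseteq> closure (cell p)"
  proof
    fix q assume q: "q \<in> ?R"
    have "(1 - s) *\<^sub>R q + s *\<^sub>R p \<in> cell p" if s: "0 < s" "s < 1" for s
      unfolding sign_cell_def
    proof (intro CollectI ballI)
      fix i assume i: "i \<in> I"
      have eq: "g i ((1 - s) *\<^sub>R q + s *\<^sub>R p) = (1 - s) * g i q + s * g i p"
        by (simp add: algebra_simps)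
      show "sgn (g i ((1 - s) *\<^sub>R q + s *\<^sub>R p)) = sgn (g i p)"
      proof (cases "g i p" "0::real" rule: linorder_cases)
        case less
        then have "(1 - s) * g i q \<le> 0" "s * g i p < 0"
          using q i s by (auto simp: mult_le_0_iff mult_less_0_iff)
        then show ?thesis unfolding eq using less by (simp add: sgn_if)
      next
        case equal
        then have "g i q = 0" using q i by force
        then show ?thesis unfolding eq using equal by simp
      next
        case greater
        then have "(1 - s) * g i q \<ge> 0" "s * g i p > 0"
          using q i s by (auto simp: zero_le_mult_iff zero_less_mult_iff)
        then show ?thesis unfolding eq using greater by (simp add: sgn_if)
      qed
    qed
    then have sub: "open_segment q p \<subseteq> cell p" by (auto simp: in_segment)
    \<comment> \<open>The case q = p is separate because the open segment is then empty.\<close>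
    show "q \<in> closure (cell p)"
    proof (cases "q = p")
      case True
      then show ?thesis using subsetD[OF closure_subset sign_cell_self] by simp
    next
      case False
      then have "q \<in> closure (open_segment q p)" by simp
      then show ?thesis using closure_mono[OF sub] by blast
    qed
  qed
qed

text \<open>The homogeneous version of the inequalities in \<open>closure_cell\<close>.\<close>

definition rec_cone :: "'a \<Rightarrow> 'a set" where
  "rec_cone p = {u. \<forall>i\<in>I. (g i p \<le> 0 \<longrightarrow> n i \<bullet> u \<le> 0) \<and> (g i p \<ge> 0 \<longrightarrow> n i \<bullet> u \<ge> 0)}"

lemma recession_cone_closure_cell: "recession_cone (closure (cell p)) = rec_cone p"
proof
  have lim: "m \<le> 0" if "\<And>c. c \<ge> 0 \<Longrightarrow> v + c * m \<le> 0" "v \<le> 0" for v m :: real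
  proof (rule ccontr)
    assume "\<not> m \<le> 0"
    \<comment> \<open>At this c the expression v + c * m equals 1.\<close>
    then show False using that(1)[of "(1 - v) / m"] that(2) by (simp add: field_simps)
  qed
  show "recession_cone (closure (cell p)) \<subseteq> rec_cone p"
  proof
    fix y assume y: "y \<in> recession_cone (closure (cell p))"
    have "p \<in> closure (cell p)" by (rule subsetD[OF closure_subset sign_cell_self])
    then have *: "p + c *\<^sub>R y \<in> closure (cell p)" if "c \<ge> 0" for c
      using y that by (simp add: recession_cone_def)
    have **: "(g i p \<le> 0 \<longrightarrow> g i p + c * (n i \<bullet> y) \<le> 0) \<and> (g i p \<ge> 0 \<longrightarrow> - g i p + c * - (n i \<bullet> y) \<le> 0)"
      if "i \<in> I" "c \<ge> 0" for i c
      using *[OF that(2)] that(1) unfolding closure_cell by (simp add: algebra_simps)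
    have "n i \<bullet> y \<le> 0" if "i \<in> I" "g i p \<le> 0" for i
      by (rule lim[of "g i p"]) (use **[OF that(1)] that(2) in blast)+
    moreover have "- (n i \<bullet> y) \<le> 0" if "i \<in> I" "g i p \<ge> 0" for i
      by (rule lim[of "- g i p"]) (use **[OF that(1)] that(2) in auto)
    ultimately show "y \<in> rec_cone p" by (auto simp: rec_cone_def)
  qed
  show "rec_cone p \<subseteq> recession_cone (closure (cell p))"
  proof
    fix y assume y: "y \<in> rec_cone p"
    show "y \<in> recession_cone (closure (cell p))"
      unfolding recession_cone_def closure_cell
    proof (intro CollectI ballI allI impI conjI)
      fix x and c :: real and i
      assume x: "x \<in> {q. \<forall>i\<in>I. (g i p \<le> 0 \<longrightarrow> g i q \<le> 0) \<and> (g i p \<ge> 0 \<longrightarrow> g i q \<ge> 0)}"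
        and c: "c \<ge> 0" and i: "i \<in> I"
      have eq: "g i (x + c *\<^sub>R y) = g i x + c * (n i \<bullet> y)" by (simp add: algebra_simps)
      show "g i (x + c *\<^sub>R y) \<le> 0" if "g i p \<le> 0"
      proof -
        have "c * (n i \<bullet> y) \<le> 0" "g i x \<le> 0"
          using y x i c that by (auto simp: rec_cone_def mult_nonneg_nonpos)
        then show ?thesis unfolding eq by linarith
      qed
      show "0 \<le> g i (x + c *\<^sub>R y)" if "g i p \<ge> 0"
      proof -
        have "c * (n i \<bullet> y) \<ge> 0" "g i x \<ge> 0"
          using y x i c that by (auto simp: rec_cone_def)
        then show ?thesis unfolding eq by linarith
      qed
    qed
  qed
qed

lemma convex_cone_rec_cone: "convex_cone (rec_cone p)"
  unfolding convex_cone_iff rec_cone_def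
  by (auto simp: inner_add_right mult_nonneg_nonpos add_nonpos_nonpos)

lemma closed_rec_cone: "closed (rec_cone p)"
proof -
  have "rec_cone p = (\<Inter>i\<in>I. (if g i p \<le> 0 then {q. n i \<bullet> q \<le> 0} else UNIV) \<inter>
      (if g i p \<ge> 0 then {q. n i \<bullet> q \<ge> 0} else UNIV))"
    by (auto simp: rec_cone_def split: if_splits)
  then show ?thesis
    by (simp add: closed_INT closed_Int closed_halfspace_le closed_halfspace_ge)
qed

text \<open>By Farkas a functional in the polar cone is a nonnegative combination of functionals
  bounded above on the cell. Conversely, a bounded functional cannot increase along a recession
  direction. This turns a condition on the cone into one on the cell itself, which slicing can
  detect.\<close>

lemma rec_cone_polar_iff_bounded:
  "(\<forall>u\<in>rec_cone p. z \<bullet> u \<le> 0) \<longleftrightarrow> (\<exists>M. \<forall>q\<in>cell p. z \<bullet> q \<le> M)"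
proof
  assume polar: "\<forall>u\<in>rec_cone p. z \<bullet> u \<le> 0"
  \<comment> \<open>These generate the polar cone; a form vanishing at p contributes both its normal
    and the negative of it.\<close>
  let ?S = "n ` {i\<in>I. g i p \<le> 0} \<union> (\<lambda>i. - n i) ` {i\<in>I. g i p \<ge> 0}"
  have "z \<in> convex_cone hull ?S"
  proof (rule farkas_convex_cone_hull)
    show "finite ?S" using finite_I by simp
    fix u assume "\<And>s. s \<in> ?S \<Longrightarrow> s \<bullet> u \<le> 0"
    then have "u \<in> rec_cone p" by (fastforce simp: rec_cone_def)
    then show "z \<bullet> u \<le> 0" using polar by blast
  qed
  also have "convex_cone hull ?S \<subseteq> {z. \<exists>M. \<forall>q\<in>cell p. z \<bullet> q \<le> M}"
  proof (rule hull_minimal, rule_tac [2] convex_cone_bounded_functionals)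
    have c: "q \<in> closure (cell p)" if "q \<in> cell p" for q using that closure_subset by blast
    show "?S \<subseteq> {z. \<exists>M. \<forall>q\<in>cell p. z \<bullet> q \<le> M}"
    proof safe
      fix i assume "i \<in> I" "g i p \<le> 0"
      then show "\<exists>M. \<forall>q\<in>cell p. n i \<bullet> q \<le> M"
        using c[unfolded closure_cell] by (intro exI[of _ "b i"]) auto
    next
      fix i assume "i \<in> I" "g i p \<ge> 0"
      then show "\<exists>M. \<forall>q\<in>cell p. (- n i) \<bullet> q \<le> M"
        using c[unfolded closure_cell] by (intro exI[of _ "- b i"]) auto
    qed
  qed
  finally show "\<exists>M. \<forall>q\<in>cell p. z \<bullet> q \<le> M" by simp
next
  assume "\<exists>M. \<forall>q\<in>cell p. z \<bullet> q \<le> M"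
  then obtain M where M: "\<And>q. q \<in> cell p \<Longrightarrow> z \<bullet> q \<le> M" by blast
  have "closure (cell p) \<subseteq> {q. z \<bullet> q \<le> M}"
    using M by (intro closure_minimal) (auto simp: closed_halfspace_le)
  moreover have "p \<in> closure (cell p)" by (rule subsetD[OF closure_subset sign_cell_self])
  ultimately have le: "z \<bullet> p + c * (z \<bullet> u) \<le> M" if "u \<in> rec_cone p" "c \<ge> 0" for u c
    using that unfolding recession_cone_closure_cell[symmetric] recession_cone_def
    by (fastforce simp: inner_add_right)
  show "\<forall>u\<in>rec_cone p. z \<bullet> u \<le> 0"
  proof (intro ballI leI notI)
    fix u assume u: "u \<in> rec_cone p" "0 < z \<bullet> u"
    have "z \<bullet> p \<le> M" using M sign_cell_self by blast
    \<comment> \<open>Moving this far from p along u gives z the value M + 1.\<close>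
    then show False using le[OF u(1), of "(M + 1 - z \<bullet> p) / (z \<bullet> u)"] u(2) by (simp add: field_simps)
  qed
qed

section \<open>Flats and the cells with a given recession direction\<close>

definition flat :: "'i set \<Rightarrow> 'a set" where
  "flat J = {p. \<forall>i\<in>J. g i p = 0}"

definition flat_dir :: "'i set \<Rightarrow> 'a set" where
  "flat_dir J = {u. \<forall>i\<in>J. n i \<bullet> u = 0}"

text \<open>The union of the cells in \<open>flat J\<close> that have \<open>y\<close> as a recession direction.\<close>

definition far :: "'i set \<Rightarrow> 'a \<Rightarrow> 'a set" where
  "far J y = {q. \<forall>i\<in>J \<union> {i\<in>I. n i \<bullet> y \<noteq> 0}. sgn (g i q) = sgn (n i \<bullet> y)}"

lemma subspace_flat_dir: "subspace (flat_dir J)"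
  by (auto simp: subspace_def flat_dir_def inner_add_right)

lemma affine_flat: "affine (flat J)"
proof -
  have "flat J = \<Inter>((\<lambda>i. {p. n i \<bullet> p = b i}) ` J)" by (auto simp: flat_def)
  then show ?thesis by (auto intro!: affine_Inter affine_hyperplane)
qed

lemma flat_add_dir: "p \<in> flat J \<Longrightarrow> u \<in> flat_dir J \<Longrightarrow> p + c *\<^sub>R u \<in> flat J"
  by (simp add: flat_def flat_dir_def inner_add_right)

lemma flat_eq_translate:
  assumes "p \<in> flat J"
  shows "flat J = (\<lambda>u. p + u) ` flat_dir J"
proof -
  have "q - p \<in> flat_dir J" if "q \<in> flat J" for q
    using that assms by (auto simp: flat_def flat_dir_def inner_diff_right)
  then have "flat J \<subseteq> (\<lambda>u. p + u) ` flat_dir J" by force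
  moreover have "(\<lambda>u. p + u) ` flat_dir J \<subseteq> flat J"
    using flat_add_dir[OF assms, of _ 1] by auto
  ultimately show ?thesis by blast
qed

lemma aff_dim_flat: "flat J \<noteq> {} \<Longrightarrow> aff_dim (flat J) = aff_dim (flat_dir J)"
  using flat_eq_translate aff_dim_translation_eq by (metis ex_in_conv)

lemma cell_subset_flat_iff: "J \<subseteq> I \<Longrightarrow> cell p \<subseteq> flat J \<longleftrightarrow> p \<in> flat J"
proof
  assume "J \<subseteq> I" "p \<in> flat J"
  then show "cell p \<subseteq> flat J"
    by (fastforce simp: sign_cell_def flat_def sgn_zero_iff)
qed (use sign_cell_self in blast)

lemma far_subset_flat: "y \<in> flat_dir J \<Longrightarrow> far J y \<subseteq> flat J"
  by (fastforce simp: far_def flat_def flat_dir_def sgn_zero_iff ball_Un)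

text \<open>Membership of y in \<open>rec_cone p\<close> constrains only forms with n i \<bullet> y
  \<noteq> 0, whose sign at p must be that of n i \<bullet> y. For i in J both quantities
  vanish.\<close>

lemma mem_far_iff:
  assumes "J \<subseteq> I" "p \<in> flat J"
  shows "p \<in> far J y \<longleftrightarrow> y \<in> rec_cone p"
proof
  assume p: "p \<in> far J y"
  show "y \<in> rec_cone p"
    unfolding rec_cone_def
  proof (intro CollectI ballI)
    fix i assume "i \<in> I"
    then have "n i \<bullet> y \<noteq> 0 \<longrightarrow> sgn (g i p) = sgn (n i \<bullet> y)" using p by (auto simp: far_def)
    then show "(g i p \<le> 0 \<longrightarrow> n i \<bullet> y \<le> 0) \<and> (0 \<le> g i p \<longrightarrow> 0 \<le> n i \<bullet> y)"
      by (auto simp: sgn_if split: if_splits)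
  qed
next
  assume y: "y \<in> rec_cone p"
  show "p \<in> far J y"
    unfolding far_def
  proof (intro CollectI ballI)
    fix i assume i: "i \<in> J \<union> {i\<in>I. n i \<bullet> y \<noteq> 0}"
    then have "i \<in> I" using assms(1) by blast
    then have *: "(g i p \<le> 0 \<longrightarrow> n i \<bullet> y \<le> 0) \<and> (0 \<le> g i p \<longrightarrow> 0 \<le> n i \<bullet> y)"
      using y by (simp add: rec_cone_def)
    moreover have "g i p = 0 \<or> n i \<bullet> y \<noteq> 0" using i assms(2) by (auto simp: flat_def)
    ultimately show "sgn (g i p) = sgn (n i \<bullet> y)"
      by (auto simp: sgn_if)
  qed
qed

lemma rec_cone_subset_flat_dir:
  assumes "J \<subseteq> I" "p \<in> flat J"
  shows "rec_cone p \<subseteq> flat_dir J"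
  using assms by (fastforce simp: rec_cone_def flat_dir_def flat_def)

lemma cell_subset_far: "J \<subseteq> I \<Longrightarrow> p \<in> far J y \<Longrightarrow> cell p \<subseteq> far J y"
  by (fastforce simp: far_def sign_cell_def)

lemma finite_far_index: "J \<subseteq> I \<Longrightarrow> finite (J \<union> {i\<in>I. n i \<bullet> y \<noteq> 0})"
  using finite_I finite_subset by auto

lemma convex_far: "J \<subseteq> I \<Longrightarrow> convex (far J y)" and rel_open_far: "J \<subseteq> I \<Longrightarrow> rel_open (far J y)"
  unfolding far_def by (intro convex_rel_open_sign_region finite_far_index; assumption)+

text \<open>Far along y the slope outweighs the value at p, so each of the finitely many forms with
  nonzero slope takes the sign of its slope, while the forms in J stay zero.\<close>

lemma add_scaled_in_far:
  assumes "y \<in> flat_dir J" "p \<in> flat J"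
  obtains R where "p + R *\<^sub>R y \<in> far J y"
proof -
  have "\<forall>\<^sub>F R in at_top. sgn (v + R * m) = sgn m" if "m \<noteq> 0" for v m :: real
    using eventually_gt_at_top[of "\<bar>v\<bar> / \<bar>m\<bar>"]
  proof eventually_elim
    case (elim R)
    then have "\<bar>v\<bar> < R * \<bar>m\<bar>" using that by (simp add: field_simps)
    then show ?case by (cases "m > 0") (auto simp: sgn_if abs_if split: if_splits)
  qed
  then have "\<forall>\<^sub>F R in at_top. \<forall>i\<in>{i\<in>I. n i \<bullet> y \<noteq> 0}. sgn (g i p + R * (n i \<bullet> y)) = sgn (n i \<bullet> y)"
    using finite_I by (intro eventually_ball_finite) auto
  from eventually_happens'[OF trivial_limit_at_top_linorder this] obtain R where R: "\<forall>i\<in>{i\<in>I. n i \<bullet> y \<noteq> 0}. sgn (g i p + R * (n i \<bullet> y)) = sgn (n i \<bullet> y)"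
    by blast
  have "g i (p + R *\<^sub>R y) = g i p + R * (n i \<bullet> y)" for i by (simp add: inner_add_right)
  moreover have "g i p = 0 \<and> n i \<bullet> y = 0" if "i \<in> J" for i
    using that assms by (simp add: flat_def flat_dir_def)
  ultimately have "p + R *\<^sub>R y \<in> far J y"
    using R unfolding far_def by (auto simp only: sgn_zero mult_zero_right add_0)
  then show thesis by (rule that)
qed

text \<open>Inside the flat, \<open>far J y\<close> is cut out by finitely many strict inequalities,
  and it is nonempty by \<open>add_scaled_in_far\<close>.\<close>

lemma aff_dim_far:
  assumes "J \<subseteq> I" "y \<in> flat_dir J" "flat J \<noteq> {}"
  shows "aff_dim (far J y) = aff_dim (flat J)"
proof -
  let ?T = "\<Inter>i\<in>{i\<in>I. n i \<bullet> y \<noteq> 0}. {q. sgn (g i q) = sgn (n i \<bullet> y)}"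
  have "open {q. sgn (g i q) = sgn (n i \<bullet> y)}" if "n i \<bullet> y \<noteq> 0" for i
  proof (cases "n i \<bullet> y > 0")
    case True
    then have "{q. sgn (g i q) = sgn (n i \<bullet> y)} = {q. n i \<bullet> q > b i}" by (auto simp: sgn_if)
    then show ?thesis by (simp add: open_halfspace_gt)
  next
    case False
    then have "{q. sgn (g i q) = sgn (n i \<bullet> y)} = {q. n i \<bullet> q < b i}" using that by (auto simp: sgn_if)
    then show ?thesis by (simp add: open_halfspace_lt)
  qed
  then have "open ?T" using finite_I by (intro open_INT) auto
  moreover have eq: "far J y = flat J \<inter> ?T"
    using assms(2) by (fastforce simp: far_def flat_def flat_dir_def sgn_zero_iff ball_Un)
  moreover have "far J y \<noteq> {}" using assms(2,3) add_scaled_in_far by blast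
  ultimately show ?thesis
    unfolding eq by (intro aff_dim_convex_Int_open affine_imp_convex affine_flat)
qed

section \<open>Signed counts of cells by recession direction and boundedness\<close>

text \<open>\<open>far J y\<close> is a union of cells, so the intersections with it in
  \<open>euler_sign_cells\<close> are the cells themselves.\<close>

lemma euler_far:
  assumes "J \<subseteq> I" "y \<in> flat_dir J" "flat J \<noteq> {}"
  shows "(\<Sum>C\<in>cell ` far J y. (-1) ^ pdim C) = ((-1) ^ pdim (flat J) :: real)"
proof -
  have "(\<lambda>p. cell p \<inter> far J y) ` far J y = cell ` far J y"
    using cell_subset_far[OF assms(1)] by (intro image_cong refl) blast
  moreover have "far J y \<noteq> {}" using assms(2,3) add_scaled_in_far by blast
  ultimately show ?thesis
    using euler_sign_cells[OF finite_I convex_far[OF assms(1)] rel_open_far[OF assms(1)], where n = n and b = b, of y]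
      aff_dim_far[OF assms] by (simp only: pdim_def not_False_eq_True simp_thms)
qed

text \<open>The unbounded cells are exactly those met by a hyperplane \<open>z \<bullet> q = c\<close> with \<open>c\<close> large, and the
  slice lowers their dimension by one.\<close>

lemma euler_far_unbounded:
  assumes J: "J \<subseteq> I" and y: "y \<in> flat_dir J" and ne: "flat J \<noteq> {}"
    and z: "z \<bullet> y = 0" and v: "v \<in> flat_dir J" "z \<bullet> v \<noteq> 0"
  shows "(\<Sum>C\<in>{C\<in>cell ` far J y. \<not> (\<exists>M. \<forall>q\<in>C. z \<bullet> q \<le> M)}. (-1) ^ pdim C) =
    ((-1) ^ pdim (flat J) :: real)"
proof -
  let ?bdd = "\<lambda>C. \<exists>M. \<forall>q\<in>C. z \<bullet> q \<le> (M::real)"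
  have "\<forall>\<^sub>F c in at_top. if ?bdd C then \<forall>q\<in>C. z \<bullet> q < c else \<exists>q\<in>C. z \<bullet> q = c"
    if C: "C \<in> range cell" for C
  proof (cases "?bdd C")
    case True
    then obtain M where "\<forall>q\<in>C. z \<bullet> q \<le> M" by blast
    then have "\<forall>q\<in>C. z \<bullet> q < c" if "c > M" for c using that by force
    then have "\<forall>\<^sub>F c in at_top. \<forall>q\<in>C. z \<bullet> q < c"
      by (rule eventually_mono[OF eventually_gt_at_top[of M]])
    then show ?thesis by (simp only: True if_True)
  next
    case False
    obtain p where p: "C = cell p" using C by blast
    have "\<exists>q\<in>C. z \<bullet> q = c" if c: "c \<ge> z \<bullet> p" for c
    proof -
      obtain q where q: "q \<in> C" "z \<bullet> q > c" using False by (meson not_le)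
      have "connected C" using p convex_cell convex_connected by blast
      then show ?thesis
        using connected_ivt_hyperplane[of C p q z c] q c sign_cell_self[of p] p by fastforce
    qed
    then have "\<forall>\<^sub>F c in at_top. \<exists>q\<in>C. z \<bullet> q = c"
      by (rule eventually_mono[OF eventually_ge_at_top[of "z \<bullet> p"]])
    then show ?thesis by (simp only: False if_False)
  qed
  \<comment> \<open>As there are finitely many cells, one level c serves all of them.\<close>
  then have "\<forall>\<^sub>F c in at_top. \<forall>C\<in>range cell. if ?bdd C then \<forall>q\<in>C. z \<bullet> q < c else \<exists>q\<in>C. z \<bullet> q = c"
    using finite_cells by (intro eventually_ball_finite) auto
  from eventually_happens'[OF trivial_limit_at_top_linorder this] obtain c where c: "\<And>C. C \<in> range cell \<Longrightarrow> if ?bdd C then \<forall>q\<in>C. z \<bullet> q < c else \<exists>q\<in>C. z \<bullet> q = c"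
    by blast
  let ?H = "{q. z \<bullet> q = c}"
  let ?U = "far J y \<inter> ?H" and ?\<C> = "{C\<in>cell ` far J y. \<not> ?bdd C}"
  \<comment> \<open>A shift along v reaches the level d within the flat; the further shift along y
    into \<open>far J y\<close> keeps the level because z is orthogonal to y.\<close>
  have level: "\<exists>q\<in>far J y. z \<bullet> q = d" for d
  proof -
    obtain p where p: "p \<in> flat J" using ne by blast
    let ?p = "p + ((d - z \<bullet> p) / (z \<bullet> v)) *\<^sub>R v"
    have "?p \<in> flat J" using p v(1) by (rule flat_add_dir)
    then obtain R where "?p + R *\<^sub>R y \<in> far J y" using add_scaled_in_far[OF y] by blast
    moreover have "z \<bullet> (?p + R *\<^sub>R y) = d" using z v(2) by (simp add: inner_add_right)
    ultimately show ?thesis by blast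
  qed
  obtain p\<^sub>0 where p0: "p\<^sub>0 \<in> far J y" "z \<bullet> p\<^sub>0 = c" using level by blast
  obtain p\<^sub>1 where p1: "p\<^sub>1 \<in> far J y" "z \<bullet> p\<^sub>1 = c + 1" using level by blast
  have U: "convex ?U" "rel_open ?U"
    by (intro convex_rel_open_Int convex_far rel_open_far J convex_hyperplane rel_open_affine affine_hyperplane)+
  \<comment> \<open>The point at level c + 1 shows that the hyperplane does not contain
    \<open>far J y\<close>, so the slice loses a dimension.\<close>
  have dimU: "pdim (flat J) = Suc (pdim ?U)"
  proof -
    have "aff_dim ?U = aff_dim (far J y) - 1"
      using aff_dim_rel_open_Int_hyperplane[OF rel_open_far[OF J] p0 p1(1)] p1(2) by simp
    moreover have "?U \<noteq> {}" using p0 by blast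
    ultimately show ?thesis
      using aff_dim_far[OF J y ne] int_pdim[OF ne] int_pdim[of ?U] by linarith
  qed
  have slice: "\<exists>q\<in>C. z \<bullet> q = c" if "C \<in> ?\<C>" for C
    using c[of C] that by (auto split: if_splits)
  \<comment> \<open>The cells of the sliced region are the slices of the unbounded cells, since
    bounded cells stay strictly below level c.\<close>
  have img: "(\<lambda>p. cell p \<inter> ?U) ` ?U = (\<lambda>C. C \<inter> ?H) ` ?\<C>"
  proof (intro equalityI subsetI)
    fix D assume "D \<in> (\<lambda>p. cell p \<inter> ?U) ` ?U"
    then obtain p where p: "p \<in> far J y" "z \<bullet> p = c" "D = cell p \<inter> ?U" by blast
    have "\<not> ?bdd (cell p)" using c[of "cell p"] p(2) sign_cell_self[of p I n b]
      by (metis less_irrefl rangeI)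
    moreover have "D = cell p \<inter> ?H" using p(3) cell_subset_far[OF J p(1)] by blast
    ultimately show "D \<in> (\<lambda>C. C \<inter> ?H) ` ?\<C>" using p(1) by blast
  next
    fix D assume "D \<in> (\<lambda>C. C \<inter> ?H) ` ?\<C>"
    then obtain C where C: "C \<in> ?\<C>" "D = C \<inter> ?H" by blast
    then obtain p where p: "p \<in> far J y" "C = cell p" by blast
    obtain q where q: "q \<in> C" "z \<bullet> q = c" using slice[OF C(1)] by blast
    have "cell q = C" "q \<in> far J y"
      using q p cell_subset_far[OF J p(1)] sign_cell_eq by blast+
    moreover have "C \<subseteq> far J y" using p cell_subset_far[OF J p(1)] by simp
    ultimately show "D \<in> (\<lambda>p. cell p \<inter> ?U) ` ?U" using C(2) q(2) by blast
  qed
  have inj: "inj_on (\<lambda>C. C \<inter> ?H) ?\<C>"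
  proof (rule inj_onI)
    fix C D assume CD: "C \<in> ?\<C>" "D \<in> ?\<C>" "C \<inter> ?H = D \<inter> ?H"
    obtain q where "q \<in> C" "z \<bullet> q = c" using slice[OF CD(1)] by blast
    then have "q \<in> C" "q \<in> D" using CD(3) by blast+
    then show "C = D" using CD(1,2) sign_cell_eq by blast
  qed
  have dimC: "pdim C = Suc (pdim (C \<inter> ?H))" if C: "C \<in> ?\<C>" for C
  proof -
    obtain q where q: "q \<in> C" "z \<bullet> q = c" using slice[OF C] by blast
    have "\<not> ?bdd C" using C by simp
    then obtain r where r: "r \<in> C" "\<not> z \<bullet> r \<le> c" by blast
    have "rel_open C" using C rel_open_cell by blast
    then have "aff_dim (C \<inter> ?H) = aff_dim C - 1"
      using aff_dim_rel_open_Int_hyperplane[OF _ q r(1)] r(2) by simp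
    moreover have "C \<inter> ?H \<noteq> {}" "C \<noteq> {}" using q by blast+
    ultimately show ?thesis using int_pdim[of C] int_pdim[of "C \<inter> ?H"] by linarith
  qed
  \<comment> \<open>Each unbounded cell has opposite sign to its slice, and the flat has opposite
    sign to \<open>?U\<close>, so the two sign changes cancel.\<close>
  have "(\<Sum>C\<in>?\<C>. (-1) ^ pdim C) = - (\<Sum>C\<in>?\<C>. (-1) ^ pdim (C \<inter> ?H) :: real)"
    unfolding sum_negf[symmetric] by (intro sum.cong refl) (simp add: dimC)
  also have "(\<Sum>C\<in>?\<C>. (-1) ^ pdim (C \<inter> ?H) :: real) = (\<Sum>D\<in>(\<lambda>C. C \<inter> ?H) ` ?\<C>. (-1) ^ pdim D)"
    by (subst sum.reindex[OF inj]) simp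
  also have "\<dots> = (-1) ^ pdim ?U"
    unfolding img[symmetric] using p0 by (intro euler_sign_cells finite_I U) blast
  finally show ?thesis by (simp add: dimU)
qed

lemma closest_point_flat_dir_iff:
  "closest_point (flat_dir J) x = y \<longleftrightarrow> y \<in> flat_dir J \<and> (\<forall>u\<in>flat_dir J. (x - y) \<bullet> u = 0)"
proof -
  have sub: "subspace (flat_dir J)" by (rule subspace_flat_dir)
  have "convex_cone (flat_dir J)"
    unfolding convex_cone_iff using sub by (simp add: subspace_def)
  then have *: "closest_point (flat_dir J) x = y \<longleftrightarrow> y \<in> flat_dir J \<and> (x - y) \<bullet> y = 0 \<and>
      (\<forall>u\<in>flat_dir J. (x - y) \<bullet> u \<le> 0)"
    by (rule closest_point_cone_iff) (simp add: closed_subspace sub)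
  have "(x - y) \<bullet> u = 0" if "\<forall>u\<in>flat_dir J. (x - y) \<bullet> u \<le> 0" "u \<in> flat_dir J" for u
    using that(1)[rule_format, OF that(2)] that(1)[rule_format, OF subspace_neg[OF sub that(2)]] by simp
  then show ?thesis unfolding * by fastforce
qed

text \<open>For a cell in the flat, projection to y means that the cell lies in
  \<open>far J y\<close>, that x - y is orthogonal to y, and that x - y is bounded above on the
  cell. If x - y annihilates \<open>flat_dir J\<close>, all cells of \<open>far J y\<close> qualify;
  otherwise the count is the difference of the equal values in \<open>euler_far\<close> and
  \<open>euler_far_unbounded\<close>.\<close>

lemma euler_closest_point:
  assumes J: "J \<subseteq> I" and ne: "flat J \<noteq> {}"
  shows "(\<Sum>C\<in>{C\<in>range cell. C \<subseteq> flat J \<and> closest_point (recession_cone (closure C)) x = y}. (-1) ^ pdim C) =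
    (if y = closest_point (flat_dir J) x then (-1) ^ pdim (flat J) else 0 :: real)"
    (is "sum _ ?S = _")
proof -
  let ?bdd = "\<lambda>C. \<exists>M. \<forall>q\<in>C. (x - y) \<bullet> q \<le> (M::real)"
  have cp: "closest_point (recession_cone (closure (cell p))) x = y \<longleftrightarrow>
      y \<in> rec_cone p \<and> (x - y) \<bullet> y = 0 \<and> ?bdd (cell p)" for p
    unfolding recession_cone_closure_cell closest_point_cone_iff[OF convex_cone_rec_cone closed_rec_cone]
      rec_cone_polar_iff_bounded ..
  show ?thesis
  proof (cases "y \<in> flat_dir J \<and> (x - y) \<bullet> y = 0")
    case False
    \<comment> \<open>The recession cones of cells in the flat lie in \<open>flat_dir J\<close>, so
      no cell can project x to such a y.\<close>
    then have "?S = {}"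
      using cp rec_cone_subset_flat_dir[OF J] cell_subset_flat_iff[OF J] by blast
    moreover have "y \<noteq> closest_point (flat_dir J) x"
      using False closest_point_flat_dir_iff by metis
    ultimately show ?thesis by (simp only: sum.empty if_False)
  next
    case True
    then have y: "y \<in> flat_dir J" and zy: "(x - y) \<bullet> y = 0" by auto
    have S: "?S = {C\<in>cell ` far J y. ?bdd C}"
    proof (intro equalityI subsetI)
      fix C assume C: "C \<in> ?S"
      then obtain p where p: "C = cell p" by blast
      then have "p \<in> flat J" using C cell_subset_flat_iff[OF J] by blast
      then show "C \<in> {C\<in>cell ` far J y. ?bdd C}"
        using C cp[of p] mem_far_iff[OF J] unfolding p by blast
    next
      fix C assume C: "C \<in> {C\<in>cell ` far J y. ?bdd C}"
      then obtain p where p: "C = cell p" "p \<in> far J y" by blast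
      then have "p \<in> flat J" using far_subset_flat[OF y] by blast
      then show "C \<in> ?S"
        using C cp[of p] mem_far_iff[OF J] p(2) zy cell_subset_flat_iff[OF J] unfolding p by blast
    qed
    show ?thesis
    proof (cases "\<forall>u\<in>flat_dir J. (x - y) \<bullet> u = 0")
      case orth: True
      \<comment> \<open>Here x - y vanishes on all of \<open>rec_cone p\<close>, hence lies in its
        polar cone.\<close>
      have "?bdd (cell p)" if "p \<in> far J y" for p
      proof -
        have "rec_cone p \<subseteq> flat_dir J"
          using that far_subset_flat[OF y] rec_cone_subset_flat_dir[OF J] by blast
        then show ?thesis using orth rec_cone_polar_iff_bounded[of p "x - y"] by fastforce
      qed
      then have "?S = cell ` far J y" unfolding S by blast
      moreover have "y = closest_point (flat_dir J) x"
        using y orth closest_point_flat_dir_iff by metis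
      ultimately show ?thesis using euler_far[OF J y ne] by simp
    next
      case False
      then obtain v where v: "v \<in> flat_dir J" "(x - y) \<bullet> v \<noteq> 0" by blast
      have fin: "finite (cell ` far J y)" by (rule finite_subset[OF _ finite_cells]) blast
      have "sum (\<lambda>C. (-1) ^ pdim C) ?S = (\<Sum>C\<in>cell ` far J y. (-1) ^ pdim C) -
          (\<Sum>C\<in>{C\<in>cell ` far J y. \<not> ?bdd C}. (-1) ^ pdim C :: real)"
      proof -
        have "{C\<in>cell ` far J y. ?bdd C} = cell ` far J y - {C\<in>cell ` far J y. \<not> ?bdd C}" by blast
        then show ?thesis unfolding S by (simp only:) (rule sum_diff[OF fin], blast)
      qed
      also have "\<dots> = 0"
        using euler_far[OF J y ne] euler_far_unbounded[OF J y ne zy v] by simp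
      finally have "sum (\<lambda>C. (-1) ^ pdim C) ?S = (0::real)" .
      moreover have "y \<noteq> closest_point (flat_dir J) x"
        using False closest_point_flat_dir_iff[of J x y] by auto
      ultimately show ?thesis by (simp only: if_False)
    qed
  qed
qed

section \<open>Intrinsic volumes of cells\<close>

text \<open>If \<open>y\<close> is a recession direction of a cell, then \<open>face_dir y\<close> is the span of the face of the
  recession cone whose relative interior contains \<open>y\<close>; it depends on \<open>y\<close> alone, not on the cell.\<close>

definition face_dir :: "'a \<Rightarrow> 'a set" where
  "face_dir y = flat_dir {i\<in>I. n i \<bullet> y = 0}"

text \<open>Each n i has a constant weak sign on the recession cone, so if it vanishes inside a
  segment of the cone it vanishes at both ends.\<close>

lemma face_of_rec_cone:
  shows "rec_cone p \<inter> face_dir y face_of rec_cone p"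
  unfolding face_of_def
proof (intro conjI ballI impI)
  show "convex (rec_cone p \<inter> face_dir y)"
    using convex_cone_rec_cone subspace_flat_dir
    by (auto simp: convex_cone_def face_dir_def intro: convex_Int subspace_imp_convex)
  fix u v x assume uv: "u \<in> rec_cone p" "v \<in> rec_cone p" and x: "x \<in> rec_cone p \<inter> face_dir y"
    and seg: "x \<in> open_segment u v"
  obtain s where s: "0 < s" "s < 1" "x = (1 - s) *\<^sub>R u + s *\<^sub>R v"
    using seg by (auto simp: in_segment)
  have "n i \<bullet> u = 0 \<and> n i \<bullet> v = 0" if i: "i \<in> I" "n i \<bullet> y = 0" for i
  proof -
    have sum: "(1 - s) * (n i \<bullet> u) + s * (n i \<bullet> v) = 0"
      using x i s by (simp add: face_dir_def flat_dir_def inner_add_right)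
    have "(n i \<bullet> u \<le> 0 \<and> n i \<bullet> v \<le> 0) \<or> (n i \<bullet> u \<ge> 0 \<and> n i \<bullet> v \<ge> 0)"
      using uv i(1) by (cases "g i p \<le> 0") (auto simp: rec_cone_def)
    then have "(1 - s) * (n i \<bullet> u) = 0 \<and> s * (n i \<bullet> v) = 0"
    proof
      assume "n i \<bullet> u \<le> 0 \<and> n i \<bullet> v \<le> 0"
      then have "(1 - s) * (n i \<bullet> u) \<le> 0" "s * (n i \<bullet> v) \<le> 0"
        using s by (simp_all add: mult_nonneg_nonpos)
      then show ?thesis using sum by linarith
    next
      assume "n i \<bullet> u \<ge> 0 \<and> n i \<bullet> v \<ge> 0"
      then have "(1 - s) * (n i \<bullet> u) \<ge> 0" "s * (n i \<bullet> v) \<ge> 0"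
        using s by simp_all
      then show ?thesis using sum by linarith
    qed
    then show ?thesis using s by simp
  qed
  then have "u \<in> face_dir y" "v \<in> face_dir y" by (simp_all add: face_dir_def flat_dir_def)
  then show "u \<in> rec_cone p \<inter> face_dir y" "v \<in> rec_cone p \<inter> face_dir y"
    using uv by blast+
qed simp

text \<open>Near y within \<open>face_dir y\<close>, the forms with n i \<bullet> y \<noteq> 0 keep
  their strict signs and the others vanish, so a neighbourhood of y in \<open>face_dir y\<close>
  lies in the cone.\<close>

lemma rel_interior_face_of_rec_cone:
  assumes y: "y \<in> rec_cone p"
  shows "y \<in> rel_interior (rec_cone p \<inter> face_dir y)"
    and "aff_dim (rec_cone p \<inter> face_dir y) = aff_dim (face_dir y)"
proof -
  let ?T = "rec_cone p \<inter> face_dir y"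
  let ?N = "(\<Inter>i\<in>{i\<in>I. n i \<bullet> y > 0}. {u. n i \<bullet> u > 0}) \<inter> (\<Inter>i\<in>{i\<in>I. n i \<bullet> y < 0}. {u. n i \<bullet> u < 0})"
  have opN: "open ?N"
    using finite_I by (intro open_Int open_INT) (auto simp: open_halfspace_gt open_halfspace_lt)
  have affine: "affine (face_dir y)"
    by (simp add: face_dir_def subspace_flat_dir subspace_imp_affine)
  have ydir: "y \<in> face_dir y" and yN: "y \<in> ?N" by (auto simp: face_dir_def flat_dir_def)
  have sub: "face_dir y \<inter> ?N \<subseteq> ?T"
  proof
    fix u assume u: "u \<in> face_dir y \<inter> ?N"
    have "(g i p \<le> 0 \<longrightarrow> n i \<bullet> u \<le> 0) \<and> (g i p \<ge> 0 \<longrightarrow> n i \<bullet> u \<ge> 0)" if i: "i \<in> I" for i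
    proof (cases "n i \<bullet> y" "0::real" rule: linorder_cases)
      case less
      then have "n i \<bullet> u < 0" "\<not> g i p \<ge> 0" using u i y by (auto simp: rec_cone_def)
      then show ?thesis by simp
    next
      case equal
      then have "n i \<bullet> u = 0" using u i by (simp add: face_dir_def flat_dir_def)
      then show ?thesis by simp
    next
      case greater
      then have "n i \<bullet> u > 0" "\<not> g i p \<le> 0" using u i y by (auto simp: rec_cone_def)
      then show ?thesis by simp
    qed
    then show "u \<in> ?T" using u by (simp add: rec_cone_def)
  qed
  have "affine hull ?T \<subseteq> face_dir y" using affine by (intro hull_minimal) auto
  then have "?N \<inter> affine hull ?T \<subseteq> ?T" using sub by blast
  then show "y \<in> rel_interior ?T"
    unfolding mem_rel_interior using opN yN ydir y by blast
  have "aff_dim (face_dir y) = aff_dim (face_dir y \<inter> ?N)"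
    by (rule aff_dim_convex_Int_open[OF affine_imp_convex[OF affine] opN, symmetric])
      (use IntI[OF ydir yN] in blast)
  also have "\<dots> \<le> aff_dim ?T" by (rule aff_dim_subset[OF sub])
  finally have "aff_dim (face_dir y) \<le> aff_dim ?T" .
  moreover have "aff_dim ?T \<le> aff_dim (face_dir y)" by (rule aff_dim_subset) blast
  ultimately show "aff_dim ?T = aff_dim (face_dir y)" by simp
qed

text \<open>Faces whose relative interiors meet coincide, so the only candidate is the face cut out
  by \<open>face_dir y\<close>. The resulting condition no longer involves p, which allows cells to
  be grouped by the projected point.\<close>

lemma ex_face_of_rec_cone_iff:
  assumes y: "y \<in> rec_cone p"
  shows "(\<exists>T. T face_of rec_cone p \<and> aff_dim T = k \<and> y \<in> rel_interior T) \<longleftrightarrow> aff_dim (face_dir y) = k"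
proof
  assume "\<exists>T. T face_of rec_cone p \<and> aff_dim T = k \<and> y \<in> rel_interior T"
  then obtain T where T: "T face_of rec_cone p" "aff_dim T = k" "y \<in> rel_interior T" by blast
  have "T = rec_cone p \<inter> face_dir y"
    using T(3) rel_interior_face_of_rec_cone(1)[OF y]
    by (intro face_of_eq[OF T(1) face_of_rec_cone]) blast
  then show "aff_dim (face_dir y) = k"
    using T(2) rel_interior_face_of_rec_cone(2)[OF y] by simp
next
  assume "aff_dim (face_dir y) = k"
  then show "\<exists>T. T face_of rec_cone p \<and> aff_dim T = k \<and> y \<in> rel_interior T"
    using face_of_rec_cone rel_interior_face_of_rec_cone[OF y] by blast
qed

lemma closest_point_in_rec_cone: "closest_point (rec_cone p) x \<in> rec_cone p"
  using convex_cone_rec_cone closed_rec_cone by (intro closest_point_in_set) (auto simp: convex_cone_def)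

section \<open>Intrinsic volumes as Gaussian measures of Borel sets\<close>

lemma intrinsic_volume_closure_cell:
  assumes "C \<in> range cell"
  shows "intrinsic_volume k (closure C) = measure gaussian_measure
    {x. aff_dim (face_dir (closest_point (recession_cone (closure C)) x)) = int k}"
  using assms
  by (auto simp: intrinsic_volume_def cone_intrinsic_volume_def recession_cone_closure_cell
      ex_face_of_rec_cone_iff[OF closest_point_in_rec_cone])

text \<open>A translate of the recession cone lies in the face, which bounds the dimensions of the
  faces of the cone. This later allows the sums over k to share one upper limit.\<close>

lemma intrinsic_volume_closure_cell_eq_0:
  assumes "C \<in> range cell" "k > pdim C"
  shows "intrinsic_volume k (closure C) = 0"
proof -
  obtain p where p: "C = cell p" using assms(1) by blast
  have "(+) p ` rec_cone p \<subseteq> closure (cell p)"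
  proof
    fix q assume "q \<in> (+) p ` rec_cone p"
    then obtain u where "u \<in> recession_cone (closure (cell p))" "q = p + 1 *\<^sub>R u"
      by (auto simp: recession_cone_closure_cell)
    moreover have "p \<in> closure (cell p)" by (rule subsetD[OF closure_subset sign_cell_self])
    ultimately show "q \<in> closure (cell p)"
      unfolding recession_cone_def by (metis (no_types, lifting) mem_Collect_eq zero_le_one)
  qed
  then have "aff_dim (rec_cone p) \<le> aff_dim (cell p)"
    using aff_dim_subset[of "(+) p ` rec_cone p" "closure (cell p)"] by (simp add: aff_dim_translation_eq)
  then have "aff_dim T \<noteq> int k" if "T face_of rec_cone p" for T
    using assms(2) aff_dim_subset[OF face_of_imp_subset[OF that]] unfolding p pdim_def by linarith
  then have "{x. \<exists>T. T face_of rec_cone p \<and> aff_dim T = int k \<and>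
      closest_point (rec_cone p) x \<in> rel_interior T} = {}" by blast
  then show ?thesis
    unfolding p intrinsic_volume_def cone_intrinsic_volume_def recession_cone_closure_cell
    by (simp only: measure_empty)
qed

text \<open>\<open>face_dir y\<close> depends only on which n i \<bullet> y vanish, so the set is a
  finite union of Borel sets, one for each admissible vanishing pattern.\<close>

lemma borel_face_dir: "{y. aff_dim (face_dir y) = k} \<in> sets borel"
proof -
  have "{y. aff_dim (face_dir y) = k} =
      (\<Union>S\<in>{S\<in>Pow I. aff_dim (flat_dir S) = k}. {y. \<forall>i\<in>I. (n i \<bullet> y = 0) = (i \<in> S)})"
    (is "?L = ?R")
  proof (intro equalityI subsetI)
    fix y assume "y \<in> ?L"
    then show "y \<in> ?R" by (intro UN_I[of "{i\<in>I. n i \<bullet> y = 0}"]) (auto simp: face_dir_def)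
  next
    fix y assume "y \<in> ?R"
    then obtain S where S: "S \<subseteq> I" "aff_dim (flat_dir S) = k" "\<forall>i\<in>I. (n i \<bullet> y = 0) = (i \<in> S)" by blast
    then have "{i\<in>I. n i \<bullet> y = 0} = S" by blast
    then show "y \<in> ?L" using S(2) by (simp add: face_dir_def)
  qed
  moreover have "{y. \<forall>i\<in>I. (n i \<bullet> y = 0) = (i \<in> S)} \<in> sets borel" for S
  proof -
    have "{y. (n i \<bullet> y = 0) = (i \<in> S)} \<in> sets borel" for i
    proof (cases "i \<in> S")
      case True
      then show ?thesis by (simp add: borel_closed closed_hyperplane)
    next
      case False
      have "- {y. n i \<bullet> y = 0} \<in> sets borel"
        by (intro borel_open open_Compl closed_hyperplane)
      moreover have "- {y. n i \<bullet> y = 0} = {y. (n i \<bullet> y = 0) = (i \<in> S)}" using False by auto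
      ultimately show ?thesis by simp
    qed
    then have "{y\<in>space borel. \<forall>i\<in>I. (n i \<bullet> y = 0) = (i \<in> S)} \<in> sets borel"
      by (intro sets.sets_Collect_finite_All finite_I) simp
    then show ?thesis by simp
  qed
  ultimately show ?thesis using finite_I by auto
qed

lemma borel_closest_point_face_dir:
  assumes "C \<in> range cell"
  shows "{x. aff_dim (face_dir (closest_point (recession_cone (closure C)) x)) = k} \<in> sets borel"
proof -
  obtain p where p: "C = cell p" using assms by blast
  have "continuous_on UNIV (closest_point (rec_cone p))"
    using convex_cone_rec_cone closed_rec_cone
    by (intro continuous_on_closest_point) (auto simp: convex_cone_def)
  then have "closest_point (rec_cone p) \<in> borel_measurable borel"
    by (rule borel_measurable_continuous_onI)
  from measurable_sets[OF this borel_face_dir[of k]] show ?thesis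
    by (simp add: p recession_cone_closure_cell vimage_def)
qed

text \<open>Orthogonal projection is self-adjoint, so n i vanishes at the projection of x iff the
  projection of n i is orthogonal to x. For almost every x this happens only if n i projects to 0,
  that is, vanishes on \<open>flat_dir J\<close>.\<close>

lemma AE_face_dir_closest_point:
  assumes "J \<subseteq> I"
  shows "AE x in gaussian_measure. face_dir (closest_point (flat_dir J) x) = flat_dir J"
proof -
  let ?\<pi> = "closest_point (flat_dir J)"
  have \<pi>: "?\<pi> x \<in> flat_dir J" "\<And>u. u \<in> flat_dir J \<Longrightarrow> (x - ?\<pi> x) \<bullet> u = 0" for x
    using closest_point_flat_dir_iff[of J x "?\<pi> x"] by auto
  have adj: "a \<bullet> ?\<pi> x = ?\<pi> a \<bullet> x" for a x
    using \<pi>(2)[OF \<pi>(1), of a x] \<pi>(2)[OF \<pi>(1), of x a]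
    unfolding inner_diff_left by (simp add: inner_commute)
  have "AE x in gaussian_measure. \<forall>i\<in>{i\<in>I. ?\<pi> (n i) \<noteq> 0}. ?\<pi> (n i) \<bullet> x \<noteq> 0"
    using finite_I by (intro AE_finite_allI AE_gaussian_inner_neq_0) auto
  then show ?thesis
  proof eventually_elim
    case (elim x)
    have "n i \<bullet> u = 0" if "i \<in> I" "n i \<bullet> ?\<pi> x = 0" "u \<in> flat_dir J" for i u
    proof -
      have "?\<pi> (n i) = 0" using elim that(1,2) adj by auto
      then show ?thesis using \<pi>(2)[OF that(3), of "n i"] by simp
    qed
    moreover have "n i \<bullet> ?\<pi> x = 0" if "i \<in> J" for i
      using \<pi>(1)[of x] that by (simp add: flat_dir_def)
    ultimately show ?case using assms by (fastforce simp: face_dir_def flat_dir_def)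
  qed
qed

lemma sum_intrinsic_volumes:
  assumes J: "J \<subseteq> I" and ne: "flat J \<noteq> {}"
  shows "(\<Sum>C\<in>{C\<in>range cell. C \<subseteq> flat J}. (-1) ^ pdim C * intrinsic_volume k (closure C)) =
    (if k = pdim (flat J) then (-1) ^ k else 0)"
proof -
  interpret prob_space "gaussian_measure :: 'a measure" by (rule prob_space_gaussian_measure)
  let ?\<C> = "{C\<in>range cell. C \<subseteq> flat J}"
  let ?P = "\<lambda>C. closest_point (recession_cone (closure C))"
  let ?A = "\<lambda>C. {x. aff_dim (face_dir (?P C x)) = int k}"
  let ?\<pi> = "closest_point (flat_dir J)"
  have fin: "finite ?\<C>" by (rule finite_subset[OF _ finite_cells]) blast
  have pointwise: "(\<Sum>C\<in>?\<C>. (-1) ^ pdim C * indicator (?A C) x) =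
      (if aff_dim (face_dir (?\<pi> x)) = int k then (-1) ^ pdim (flat J) else 0 :: real)" for x
  proof -
    \<comment> \<open>Including \<open>?\<pi> x\<close> guarantees that the one index with a nonzero
      count belongs to the sum, without exhibiting a cell that projects x there.\<close>
    let ?Y = "insert (?\<pi> x) ((\<lambda>C. ?P C x) ` ?\<C>)"
    have "(\<Sum>C\<in>?\<C>. (-1) ^ pdim C * indicator (?A C) x) =
        (\<Sum>y\<in>?Y. \<Sum>C\<in>{C\<in>?\<C>. ?P C x = y}. (-1) ^ pdim C * indicator (?A C) x :: real)"
      by (rule sum.group[symmetric]) (use fin in auto)
    also have "\<dots> = (\<Sum>y\<in>?Y. of_bool (aff_dim (face_dir y) = int k) *
        (\<Sum>C\<in>{C\<in>range cell. C \<subseteq> flat J \<and> ?P C x = y}. (-1) ^ pdim C))"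
      unfolding sum_distrib_left by (intro sum.cong) (auto simp: indicator_def)
    also have "\<dots> = (\<Sum>y\<in>?Y. if y = ?\<pi> x then
        (if aff_dim (face_dir (?\<pi> x)) = int k then (-1) ^ pdim (flat J) else 0) else 0)"
      unfolding euler_closest_point[OF J ne] by (intro sum.cong refl) simp
    also have "\<dots> = (if aff_dim (face_dir (?\<pi> x)) = int k then (-1) ^ pdim (flat J) else 0)"
      using fin by (subst sum.delta) auto
    finally show ?thesis .
  qed
  have dim: "aff_dim (flat_dir J) = int (pdim (flat J))"
    using aff_dim_flat[OF ne] int_pdim[OF ne] by simp
  \<comment> \<open>Almost surely \<open>face_dir (?\<pi> x)\<close> is \<open>flat_dir J\<close>,
    whose dimension is that of the flat, so the condition on x becomes k = dimension of the
    flat.\<close>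
  have ae: "AE x in gaussian_measure. (\<Sum>C\<in>?\<C>. (-1) ^ pdim C * indicator (?A C) x) =
      (if k = pdim (flat J) then (-1) ^ k else 0 :: real)"
    using AE_face_dir_closest_point[OF J] by eventually_elim (simp only: pointwise dim, simp)
  have meas: "?A C \<in> sets gaussian_measure" if "C \<in> ?\<C>" for C
    using that borel_closest_point_face_dir by simp
  have "(\<Sum>C\<in>?\<C>. (-1) ^ pdim C * intrinsic_volume k (closure C)) =
      (\<Sum>C\<in>?\<C>. \<integral>x. (-1) ^ pdim C * indicator (?A C) x \<partial>gaussian_measure)"
    by (intro sum.cong refl) (simp add: intrinsic_volume_closure_cell)
  also have "\<dots> = (\<integral>x. (\<Sum>C\<in>?\<C>. (-1) ^ pdim C * indicator (?A C) x) \<partial>gaussian_measure)"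
    using meas
    by (intro Bochner_Integration.integral_sum[symmetric] integrable_mult_right integrable_real_indicator)
      (auto simp: emeasure_eq_measure)
  also have "\<dots> = (\<integral>x. (if k = pdim (flat J) then (-1) ^ k else 0) \<partial>(gaussian_measure :: 'a measure))"
    using ae meas
    by (intro integral_cong_AE borel_measurable_sum borel_measurable_times borel_measurable_const
        borel_measurable_indicator) auto
  finally show ?thesis by (simp add: prob_space[unfolded space_gaussian_measure])
qed

end

section \<open>Hyperplane arrangements\<close>

context affine_forms
begin

text \<open>If a direction fixing all forms that vanish at p changed another form, moving along it
  or its negative would hit a new hyperplane at a point of a smaller face. So the forms vanishing at
  p already cut out \<open>flat_dir I\<close>, and the cell is a translate of it.\<close>

lemma aff_dim_minimal_cell:
  assumes min: "\<And>q. closure (cell q) \<subseteq> closure (cell p) \<Longrightarrow> closure (cell q) = closure (cell p)"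
  shows "aff_dim (cell p) = aff_dim (flat_dir I)"
proof -
  let ?Z = "{i\<in>I. g i p = 0}"
  have no_exit: "\<not> g i p * (n i \<bullet> u) < 0" if u: "u \<in> flat_dir ?Z" and i: "i \<in> I" for u i
  proof
    assume neg: "g i p * (n i \<bullet> u) < 0"
    let ?B = "{j\<in>I. g j p * (n j \<bullet> u) < 0}"
    \<comment> \<open>The time at which the ray from p along u meets hyperplane j; the set
      \<open>?B\<close> collects the forms moving towards zero, and the minimum is the first
      hit.\<close>
    let ?s = "\<lambda>j. - g j p / (n j \<bullet> u)"
    have B: "finite (?s ` ?B)" "?s ` ?B \<noteq> {}" using finite_I i neg by auto
    obtain j where j: "j \<in> I" "g j p * (n j \<bullet> u) < 0" and sj: "Min (?s ` ?B) = ?s j"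
      using Min_in[OF B] by blast
    define s where "s = ?s j"
    have s_le: "s \<le> ?s k" if "k \<in> I" "g k p * (n k \<bullet> u) < 0" for k
      using Min_le[OF B(1), of "?s k"] that unfolding s_def sj[symmetric] by blast
    have s_pos: "s > 0"
      using j(2) unfolding s_def by (auto simp: mult_less_0_iff zero_less_divide_iff)
    let ?q = "p + s *\<^sub>R u"
    have q: "g k ?q = g k p + s * (n k \<bullet> u)" for k by (simp add: inner_add_right)
    have "?q \<in> closure (cell p)"
      unfolding closure_cell
    proof (intro CollectI ballI)
      fix k assume k: "k \<in> I"
      show "(g k p \<le> 0 \<longrightarrow> g k ?q \<le> 0) \<and> (g k p \<ge> 0 \<longrightarrow> g k ?q \<ge> 0)"
      proof (cases "g k p" "0::real" rule: linorder_cases)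
        case less
        have "g k p + s * (n k \<bullet> u) \<le> 0"
        proof (cases "n k \<bullet> u > 0")
          case True
          then have "s \<le> ?s k" using less k by (intro s_le) (auto simp: mult_less_0_iff)
          then show ?thesis using True by (simp add: field_simps)
        next
          case False
          then have "s * (n k \<bullet> u) \<le> 0" using s_pos by (simp add: mult_nonneg_nonpos)
          then show ?thesis using less by linarith
        qed
        then show ?thesis unfolding q using less by linarith
      next
        case equal
        then have "n k \<bullet> u = 0" using u k by (simp add: flat_dir_def)
        then show ?thesis unfolding q using equal by simp
      next
        case greater
        have "g k p + s * (n k \<bullet> u) \<ge> 0"
        proof (cases "n k \<bullet> u < 0")
          case True
          then have "s \<le> ?s k" using greater k by (intro s_le) (auto simp: mult_less_0_iff)
          then show ?thesis using True by (simp add: field_simps)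
        next
          case False
          then have "s * (n k \<bullet> u) \<ge> 0" using s_pos by simp
          then show ?thesis using greater by linarith
        qed
        then show ?thesis unfolding q using greater by linarith
      qed
    qed
    \<comment> \<open>Minimality now forces \<open>?q\<close> and p into the same cell, although
      form j vanishes at \<open>?q\<close> and not at p.\<close>
    then have "closure (cell ?q) \<subseteq> closure (cell p)" unfolding closure_cell by auto
    then have "closure (cell ?q) = closure (cell p)" by (rule min)
    then have "cell ?q = cell p" using inj_onD[OF inj_on_closure_cells] by blast
    then have "p \<in> cell ?q" using sign_cell_self by blast
    moreover have "n j \<bullet> u \<noteq> 0" using j(2) by auto
    then have "g j ?q = 0" by (simp add: s_def inner_add_right)
    ultimately have "g j p = 0" using j(1) by (auto simp: sign_cell_def sgn_zero_iff)
    then show False using j(2) by simp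
  qed
  have "flat_dir ?Z \<subseteq> flat_dir I"
  proof
    fix u assume u: "u \<in> flat_dir ?Z"
    \<comment> \<open>Excluding decrease towards zero along both u and -u leaves only forms constant
      along u.\<close>
    have "- u \<in> flat_dir ?Z" using subspace_neg[OF subspace_flat_dir u] .
    have "n i \<bullet> u = 0" if "i \<in> I" for i
    proof (cases "g i p = 0")
      case True
      then show ?thesis using u that by (simp add: flat_dir_def)
    next
      case False
      have "g i p * (n i \<bullet> u) \<ge> 0" "- (g i p * (n i \<bullet> u)) \<ge> 0"
        using no_exit[OF u that] no_exit[OF \<open>- u \<in> flat_dir ?Z\<close> that] by simp_all
      then have "g i p * (n i \<bullet> u) = 0" by linarith
      then show ?thesis using False by simp
    qed
    then show "u \<in> flat_dir I" by (simp add: flat_dir_def)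
  qed
  moreover have pZ: "p \<in> flat ?Z" by (simp add: flat_def)
  moreover have "cell p \<subseteq> flat ?Z" using cell_subset_flat_iff[of ?Z p] pZ by blast
  ultimately have "cell p \<subseteq> (\<lambda>u. p + u) ` flat_dir I" using flat_eq_translate[OF pZ] by blast
  then have "aff_dim (cell p) \<le> aff_dim (flat_dir I)"
    using aff_dim_subset aff_dim_translation_eq by metis
  moreover have "(\<lambda>u. p + u) ` flat_dir I \<subseteq> cell p"
    by (auto simp: flat_dir_def sign_cell_def inner_add_right)
  then have "aff_dim (flat_dir I) \<le> aff_dim (cell p)"
    using aff_dim_subset aff_dim_translation_eq by metis
  ultimately show ?thesis by simp
qed

end

section \<open>Faces, flats and supports of an arrangement in terms of signs\<close>

text \<open>Any two equations of one hyperplane are proportional, so the open sides do not depend on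
  the equation chosen; a negative factor exchanges them.\<close>

lemma open_side_iff:
  assumes a: "a \<noteq> 0" and H: "H = {x. a \<bullet> x = c}"
  shows "open_side H S \<longleftrightarrow> S = {x. a \<bullet> x < c} \<or> S = {x. a \<bullet> x > c}"
proof
  assume "open_side H S"
  then obtain a' c' where a': "a' \<noteq> 0" "H = {x. a' \<bullet> x = c'}" "S = {x. a' \<bullet> x < c'}"
    unfolding open_side_def by blast
  \<comment> \<open>Here r * a is the component of a' along a, and x0 is the point of H closest to
    the origin. The remainder a' - r * a is a direction of H, hence orthogonal to a' as well as to
    a, and so zero.\<close>
  define r where "r = (a \<bullet> a') / (a \<bullet> a)"
  define x0 where "x0 = (c / (a \<bullet> a)) *\<^sub>R a"
  have x0: "a \<bullet> x0 = c" using a by (simp add: x0_def)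
  then have x0': "a' \<bullet> x0 = c'" using H a'(2) by blast
  have orth: "a \<bullet> (a' - r *\<^sub>R a) = 0" using a by (simp add: r_def inner_diff_right)
  then have "a \<bullet> (x0 + (a' - r *\<^sub>R a)) = c" using x0 by (simp only: inner_add_right)
  then have "a' \<bullet> (x0 + (a' - r *\<^sub>R a)) = c'" using H a'(2) by blast
  then have "a' \<bullet> (a' - r *\<^sub>R a) = 0" using x0' by (simp only: inner_add_right)
  then have "(a' - r *\<^sub>R a) \<bullet> (a' - r *\<^sub>R a) = 0"
    using orth by (simp only: inner_diff_left[of a'] inner_scaleR_left)
  then have eq: "a' = r *\<^sub>R a" by simp
  then have c': "c' = r * c" using x0 x0' by auto
  have "r \<noteq> 0" using eq a'(1) by auto
  then consider "r > 0" | "r < 0" by linarith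
  then show "S = {x. a \<bullet> x < c} \<or> S = {x. a \<bullet> x > c}"
    by cases (auto simp: a'(3) eq c')
next
  assume "S = {x. a \<bullet> x < c} \<or> S = {x. a \<bullet> x > c}"
  then show "open_side H S"
  proof
    assume "S = {x. a \<bullet> x < c}"
    then show ?thesis using a H unfolding open_side_def by blast
  next
    assume "S = {x. a \<bullet> x > c}"
    then have "- a \<noteq> 0 \<and> H = {x. - a \<bullet> x = - c} \<and> S = {x. - a \<bullet> x < - c}" using a H by auto
    then show ?thesis unfolding open_side_def by blast
  qed
qed

text \<open>Each hyperplane indexes its own form, with one equation fixed for it, so index sets J
  are subfamilies of the arrangement and \<open>flat J\<close> is their intersection.\<close>

locale arrangement_forms = affine_forms \<A> n b
  for \<A> :: "'a::euclidean_space set set" and n :: "'a set \<Rightarrow> 'a" and b +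
  assumes normal_nonzero: "H \<in> \<A> \<Longrightarrow> n H \<noteq> 0"
    and hyperplane_eq: "H \<in> \<A> \<Longrightarrow> H = {x. n H \<bullet> x = b H}"
begin

lemma side_iff:
  assumes "H \<in> \<A>"
  shows "S = H \<or> open_side H S \<longleftrightarrow> (\<exists>p. S = {q. sgn (g H q) = sgn (g H p)})"
proof -
  have S: "{q. sgn (g H q) = 0} = {x. n H \<bullet> x = b H}" "{q. sgn (g H q) = -1} = {x. n H \<bullet> x < b H}"
    "{q. sgn (g H q) = 1} = {x. n H \<bullet> x > b H}"
    by (auto simp: sgn_if)
  have "\<exists>p. sgn (g H p) = t" if "t \<in> {0, -1, 1}" for t
  proof -
    \<comment> \<open>The multiple of the normal at which the form takes the value t, so every sign
      is attained.\<close>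
    let ?p = "((b H + t) / (n H \<bullet> n H)) *\<^sub>R n H"
    have "g H ?p = t" using normal_nonzero[OF assms] by simp
    then show ?thesis using that by (intro exI[of _ ?p]) (auto simp: sgn_if)
  qed
  moreover have "sgn (g H p) \<in> {0, -1, 1}" for p by (auto simp: sgn_if)
  ultimately have "(\<exists>p. S = {q. sgn (g H q) = sgn (g H p)}) \<longleftrightarrow> (\<exists>t\<in>{0, -1, 1}. S = {q. sgn (g H q) = t})"
    by metis
  also have "\<dots> \<longleftrightarrow> S = H \<or> open_side H S"
    unfolding open_side_iff[OF normal_nonzero[OF assms] hyperplane_eq[OF assms]]
    using hyperplane_eq[OF assms] by (simp only: S bex_simps simp_thms)
  finally show ?thesis by blast
qed

text \<open>A choice of sides with a common point p must be the choice given by the signs at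
  p.\<close>

lemma cells_eq: "cells \<A> = range cell"
proof (intro equalityI subsetI)
  fix C assume "C \<in> cells \<A>"
  then obtain s p where s: "\<forall>H\<in>\<A>. s H = H \<or> open_side H (s H)" and C: "C = (\<Inter>H\<in>\<A>. s H)" and p: "p \<in> C"
    unfolding cells_def by blast
  have "s H = {q. sgn (g H q) = sgn (g H p)}" if H: "H \<in> \<A>" for H
  proof -
    have "s H = H \<or> open_side H (s H)" using s H by (rule bspec)
    then obtain p' where "s H = {q. sgn (g H q) = sgn (g H p')}"
      unfolding side_iff[OF H] by (rule exE)
    moreover have "p \<in> s H" using p C H by blast
    ultimately show ?thesis by simp
  qed
  then have "C = cell p" unfolding C sign_cell_def by auto
  then show "C \<in> range cell" by blast
next
  fix C assume "C \<in> range cell"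
  then obtain p where p: "C = cell p" by blast
  let ?s = "\<lambda>H. {q. sgn (g H q) = sgn (g H p)}"
  have "\<forall>H\<in>\<A>. ?s H = H \<or> open_side H (?s H)"
    by (intro ballI side_iff[THEN iffD2] exI[of _ p] refl)
  moreover have "C = (\<Inter>H\<in>\<A>. ?s H)" unfolding p sign_cell_def by auto
  moreover have "C \<noteq> {}" using p sign_cell_self by blast
  ultimately show "C \<in> cells \<A>" unfolding cells_def by (intro CollectI conjI exI[of _ ?s])
qed

lemma faces_eq: "faces \<A> = closure ` range cell"
  by (simp add: faces_def cells_eq)

lemma finite_faces: "finite (faces \<A>)"
  unfolding faces_eq by (intro finite_imageI finite_cells)

lemma Inter_eq_flat: "J \<subseteq> \<A> \<Longrightarrow> \<Inter>J = flat J"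
  using hyperplane_eq unfolding flat_def by fastforce

lemma flats_eq: "flats \<A> = {flat J |J. J \<subseteq> \<A> \<and> flat J \<noteq> {}}"
  unfolding flats_def using Inter_eq_flat by (smt (verit, best) Collect_cong)

text \<open>The support is the intersection of all hyperplanes through p, because a flat contains
  the face as soon as it contains p. Thus \<open>tits_char\<close> sums over exactly the cells in
  the flat.\<close>

lemma supp_subset_iff:
  assumes J: "J \<subseteq> \<A>"
  shows "supp \<A> (closure (cell p)) \<subseteq> flat J \<longleftrightarrow> cell p \<subseteq> flat J"
proof -
  have closure_iff: "closure (cell p) \<subseteq> flat K \<longleftrightarrow> p \<in> flat K" if "K \<subseteq> \<A>" for K
    using cell_subset_flat_iff[OF that, of p] affine_closed[OF affine_flat[of K]]
      closure_minimal[of "cell p" "flat K"] closure_subset[of "cell p"] by blast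
  let ?Z = "{H\<in>\<A>. g H p = 0}"
  have sub: "flat ?Z \<subseteq> flat K \<longleftrightarrow> p \<in> flat K" if "K \<subseteq> \<A>" for K
    using that unfolding flat_def by blast
  have pZ: "p \<in> flat ?Z" by (simp add: flat_def)
  have "supp \<A> (closure (cell p)) = flat ?Z"
    unfolding supp_def
  proof (rule Least_equality)
    show "flat ?Z \<in> flats \<A> \<and> closure (cell p) \<subseteq> flat ?Z"
      using pZ closure_iff[of ?Z] unfolding flats_eq by blast
    fix X assume "X \<in> flats \<A> \<and> closure (cell p) \<subseteq> X"
    then obtain K where "K \<subseteq> \<A>" "X = flat K" "closure (cell p) \<subseteq> flat K" unfolding flats_eq by blast
    then show "flat ?Z \<subseteq> X" using sub closure_iff by blast
  qed
  then show ?thesis using sub[OF J] cell_subset_flat_iff[OF J] by simp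
qed

text \<open>As \<open>min_dim\<close> is a definite description, a minimal face must exist, which
  finiteness provides, and all minimal faces must have the same dimension, which
  \<open>aff_dim_minimal_cell\<close> provides.\<close>

lemma min_dim_eq: "int (min_dim \<A>) = aff_dim (flat_dir \<A>)"
proof -
  have dir_ne: "flat_dir \<A> \<noteq> {}" using subspace_0[OF subspace_flat_dir] by blast
  have dim: "pdim F = pdim (flat_dir \<A>)" if F: "F \<in> minimal_faces \<A>" for F
  proof -
    obtain p where p: "F = closure (cell p)"
      using F unfolding minimal_faces_def faces_eq by blast
    have "closure (cell q) = closure (cell p)" if "closure (cell q) \<subseteq> closure (cell p)" for q
      using F that unfolding minimal_faces_def faces_eq p by blast
    then have "aff_dim (cell p) = aff_dim (flat_dir \<A>)" by (rule aff_dim_minimal_cell)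
    then show ?thesis by (simp add: p pdim_def)
  qed
  obtain F where "F \<in> minimal_faces \<A>"
  proof -
    have "faces \<A> \<noteq> {}" unfolding faces_eq by blast
    then obtain F where "F \<in> faces \<A>" "\<forall>G\<in>faces \<A>. G \<subseteq> F \<longrightarrow> F = G"
      using finite_has_minimal[OF finite_faces] by blast
    then show thesis using that unfolding minimal_faces_def by blast
  qed
  then have "min_dim \<A> = pdim (flat_dir \<A>)"
    unfolding min_dim_def using dim by (intro the_equality) auto
  then show ?thesis using int_pdim[OF dir_ne] by simp
qed

text \<open>Makes the natural-number exponent \<open>pdim (flat J) - min_dim \<A>\<close> a true
  difference and puts the surviving index into the range of summation.\<close>

lemma min_dim_le_pdim_flat:
  assumes "J \<subseteq> \<A>" "flat J \<noteq> {}"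
  shows "min_dim \<A> \<le> pdim (flat J)"
proof -
  have "flat_dir \<A> \<subseteq> flat_dir J" using assms(1) by (auto simp: flat_dir_def)
  then have "aff_dim (flat_dir \<A>) \<le> aff_dim (flat_dir J)" by (rule aff_dim_subset)
  then show ?thesis
    using min_dim_eq aff_dim_flat[OF assms(2)] int_pdim[OF assms(2)] by linarith
qed

section \<open>Characters of the intrinsic element\<close>

lemma lookup_intrinsic_element:
  "Poly_Mapping.lookup (intrinsic_element \<A> t) F = (if F \<in> faces \<A> then (-1) ^ pdim F *
      (\<Sum>k = min_dim \<A>..pdim F. (-1) ^ k * intrinsic_volume k F * t ^ (k - min_dim \<A>)) else 0)"
  unfolding intrinsic_element_def lookup_sum lookup_single
  using finite_faces by (simp add: when_def)

text \<open>Extending every inner sum to the dimension of the flat adds only zero intrinsic volumes,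
  after which the two sums can be exchanged. By \<open>sum_intrinsic_volumes\<close> only the top k
  survives, and its two signs (-1)^k cancel.\<close>

lemma tits_char_intrinsic_element:
  assumes J: "J \<subseteq> \<A>" and ne: "flat J \<noteq> {}"
  shows "tits_char \<A> (flat J) (intrinsic_element \<A> t) = t ^ (pdim (flat J) - min_dim \<A>)"
proof -
  let ?d = "min_dim \<A>" and ?m = "pdim (flat J)"
  let ?\<C> = "{C\<in>range cell. C \<subseteq> flat J}"
  let ?v = "\<lambda>k C. intrinsic_volume k (closure C)"
  have faces: "{F \<in> faces \<A>. supp \<A> F \<subseteq> flat J} = closure ` ?\<C>"
    unfolding faces_eq using supp_subset_iff[OF J] by blast
  have inj: "inj_on closure ?\<C>" by (rule inj_on_subset[OF inj_on_closure_cells]) blast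
  have "tits_char \<A> (flat J) (intrinsic_element \<A> t) =
      (\<Sum>C\<in>?\<C>. Poly_Mapping.lookup (intrinsic_element \<A> t) (closure C))"
    unfolding tits_char_def faces by (simp only: sum.reindex[OF inj] o_def)
  also have "\<dots> = (\<Sum>C\<in>?\<C>. \<Sum>k = ?d..?m. (-1) ^ k * t ^ (k - ?d) * ((-1) ^ pdim C * ?v k C))"
  proof (rule sum.cong[OF refl])
    fix C assume C: "C \<in> ?\<C>"
    then have "C \<noteq> {}" using sign_cell_self by blast
    then have "pdim C \<le> ?m"
      using C aff_dim_subset[of C "flat J"] int_pdim[of C] int_pdim[OF ne] by simp
    then have "(\<Sum>k = ?d..pdim C. (-1) ^ k * ?v k C * t ^ (k - ?d)) =
        (\<Sum>k = ?d..?m. (-1) ^ k * ?v k C * t ^ (k - ?d))"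
      using C by (intro sum.mono_neutral_left) (auto simp: intrinsic_volume_closure_cell_eq_0)
    moreover have "closure C \<in> faces \<A>" using C faces_eq by blast
    ultimately show "Poly_Mapping.lookup (intrinsic_element \<A> t) (closure C) =
        (\<Sum>k = ?d..?m. (-1) ^ k * t ^ (k - ?d) * ((-1) ^ pdim C * ?v k C))"
      by (simp add: lookup_intrinsic_element pdim_closure_cell sum_distrib_left mult_ac)
  qed
  also have "\<dots> = (\<Sum>k = ?d..?m. (-1) ^ k * t ^ (k - ?d) * (\<Sum>C\<in>?\<C>. (-1) ^ pdim C * ?v k C))"
    by (subst sum.swap) (simp only: sum_distrib_left)
  also have "\<dots> = (\<Sum>k = ?d..?m. if k = ?m then t ^ (?m - ?d) else 0)"
    unfolding sum_intrinsic_volumes[OF J ne]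
    by (intro sum.cong refl) (simp add: mult_ac flip: power_mult_distrib)
  also have "\<dots> = t ^ (?m - ?d)"
    using min_dim_le_pdim_flat[OF J ne] by (simp add: sum.delta)
  finally show ?thesis .
qed

lemma characteristic_intrinsic_element: "characteristic \<A> t (intrinsic_element \<A> t)"
proof -
  have "intrinsic_element \<A> t \<in> tits_algebra \<A>"
    by (auto simp: tits_algebra_def in_keys_iff lookup_intrinsic_element split: if_splits)
  then show ?thesis
    using tits_char_intrinsic_element
    unfolding characteristic_def flats_eq flat_rank_def by blast
qed

end

theorem theorem6p1:
  fixes \<A> :: "(real ^ 'n) set set" and t :: real
  assumes "hyperplane_arrangement \<A>"
  shows "characteristic \<A> t (intrinsic_element \<A> t)"
proof -
  have "\<forall>H\<in>\<A>. \<exists>ac. fst ac \<noteq> 0 \<and> H = {x. fst ac \<bullet> x = snd ac}"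
    using assms unfolding hyperplane_arrangement_def hyperplane_def by force
  then obtain f where f: "\<forall>H\<in>\<A>. fst (f H) \<noteq> 0 \<and> H = {x. fst (f H) \<bullet> x = snd (f H)}"
    by (rule bchoice[THEN exE])
  interpret arrangement_forms \<A> "\<lambda>H. fst (f H)" "\<lambda>H. snd (f H)"
    by unfold_locales (use f assms in \<open>auto simp: hyperplane_arrangement_def\<close>)
  show ?thesis by (rule characteristic_intrinsic_element)
qed

end
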